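(* There is an absolute constant $C>0$ such that the following holds. Let $1\le p\le +\infty$ and let $T:C([0,1])\to C([0,1])$ be a sublinear, monotone and strongly translatable operator. If $f\in W_{\infty}^{2}([0,1])$, then $$\|f-T(f)\|_{p}\le C\cdot \|f\|_{2,\infty}\cdot \lambda_{p},$$ where $$\lambda_{p}=\max\{\|T(e_0)-e_0\|_{p},\ \|T(e_1)-e_1\|_{p},\ \|T(-e_1)+e_1\|_{p},\ \|T(e_2)-e_2\|_{p}\}.$$
   Context: Functions are real-valued; $e_0(x)=1$, $e_1(x)=x$, $e_2(x)=x^2$ on $[0,1]$; $\|\cdot\|_p$ is the norm of $L_p([0,1])$. An operator $T:E\to E$ (not assumed linear) on an ordered space $E$ of real functions containing the constants, with pointwise ordering, is called: - sublinear if $T(f+g)\le T(f)+T(g)$ and $T(\alpha f)=\alpha T(f)$ for all $f,g\in E$ and $\alpha\ge 0$; - monotone if $f\le g$ implies $T(f)\le T(g)$ for all $f,g\in E$; - strongly translatable if $T(f+\alpha\cdot 1)=T(f)+\alpha T(1)$ for all $f\in E$ and all $\alpha\in\mathbb{R}$. For an integer $r\ge 0$ and $1\le p\le+\infty$, $W_p^r([0,1])$ is the Sobolev space of all $f\in L_p([0,1])$ whose derivatives $f^{(j)}$ (in the Sobolev sense) exist and belong to $L_p([0,1])$ for $j=0,1,\dots,r$, with norm $\|f\|_{r,p}=\max_{j=0,\dots,r}\|f^{(j)}\|_p$. An element of $W_\infty^2([0,1])$ is identified with its continuous representative, so that $T(f)$ makes sense. *)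

theory Defs
  imports "HOL-Analysis.Analysis" "HOL-Probability.Essential_Supremum"
begin

text \<open>
  A space of real functions on a set \<open>X\<close> is represented by a set \<open>E\<close> of total functions of which
  only the values on \<open>X\<close> are relevant; equality and order are therefore always tested on \<open>X\<close> only,
  and an operator has to respect equality on \<open>X\<close>. The predicates below make sense when \<open>E\<close> is
  closed under the operations involved, as is the case for \<open>C01\<close>.
\<close>

definition operator_on :: "'a set \<Rightarrow> ('a \<Rightarrow> real) set \<Rightarrow> (('a \<Rightarrow> real) \<Rightarrow> 'a \<Rightarrow> real) \<Rightarrow> bool" where
  "operator_on X E T \<longleftrightarrow>
     (\<forall>f\<in>E. T f \<in> E) \<and>
     (\<forall>f\<in>E. \<forall>g\<in>E. (\<forall>x\<in>X. f x = g x) \<longrightarrow> (\<forall>x\<in>X. T f x = T g x))"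

definition sublinear_on :: "'a set \<Rightarrow> ('a \<Rightarrow> real) set \<Rightarrow> (('a \<Rightarrow> real) \<Rightarrow> 'a \<Rightarrow> real) \<Rightarrow> bool" where
  "sublinear_on X E T \<longleftrightarrow>
     (\<forall>f\<in>E. \<forall>g\<in>E. \<forall>x\<in>X. T (\<lambda>t. f t + g t) x \<le> T f x + T g x) \<and>
     (\<forall>f\<in>E. \<forall>\<alpha>\<ge>0. \<forall>x\<in>X. T (\<lambda>t. \<alpha> * f t) x = \<alpha> * T f x)"

definition monotone_operator_on :: "'a set \<Rightarrow> ('a \<Rightarrow> real) set \<Rightarrow> (('a \<Rightarrow> real) \<Rightarrow> 'a \<Rightarrow> real) \<Rightarrow> bool" where
  "monotone_operator_on X E T \<longleftrightarrow>
     (\<forall>f\<in>E. \<forall>g\<in>E. (\<forall>x\<in>X. f x \<le> g x) \<longrightarrow> (\<forall>x\<in>X. T f x \<le> T g x))"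

definition strongly_translatable_on :: "'a set \<Rightarrow> ('a \<Rightarrow> real) set \<Rightarrow> (('a \<Rightarrow> real) \<Rightarrow> 'a \<Rightarrow> real) \<Rightarrow> bool" where
  "strongly_translatable_on X E T \<longleftrightarrow>
     (\<forall>f\<in>E. \<forall>\<alpha>::real. \<forall>x\<in>X. T (\<lambda>t. f t + \<alpha>) x = T f x + \<alpha> * T (\<lambda>t. 1) x)"

definition C01 :: "(real \<Rightarrow> real) set" where
  "C01 = {f. continuous_on {0..1} f}"

definition e_fun :: "nat \<Rightarrow> real \<Rightarrow> real" where
  "e_fun k = (\<lambda>x. x ^ k)"

text \<open>
  The exponent ranges over \<^typ>\<open>ennreal\<close>, with \<open>\<infinity>\<close> included. Elements are genuine functions, not
  equivalence classes. \<open>Lp_norm\<close> is real-valued and is only meaningful on \<open>Lp_space\<close>.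
\<close>

abbreviation leb01 :: "real measure" where
  "leb01 \<equiv> lebesgue_on {0..1}"

definition Lp_space :: "ennreal \<Rightarrow> (real \<Rightarrow> real) set" where
  "Lp_space p = {f \<in> borel_measurable leb01.
     if p = \<infinity> then \<exists>B. AE x in leb01. \<bar>f x\<bar> \<le> B
     else integrable leb01 (\<lambda>x. \<bar>f x\<bar> powr enn2real p)}"

definition Lp_norm :: "ennreal \<Rightarrow> (real \<Rightarrow> real) \<Rightarrow> real" where
  "Lp_norm p f =
     (if p = \<infinity> then real_of_ereal (esssup leb01 (\<lambda>x. ereal \<bar>f x\<bar>))
      else (\<integral>x. \<bar>f x\<bar> powr enn2real p \<partial>leb01) powr (1 / enn2real p))"

text \<open>The closed support is automatically compact, being a subset of a bounded set.\<close>

definition test_fun :: "(real \<Rightarrow> real) \<Rightarrow> bool" where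
  "test_fun \<phi> \<longleftrightarrow>
     (\<forall>n x. (deriv ^^ n) \<phi> differentiable (at x)) \<and>
     closure {x. \<phi> x \<noteq> 0} \<subseteq> {0<..<1}"

definition locally_integrable :: "(real \<Rightarrow> real) \<Rightarrow> bool" where
  "locally_integrable f \<longleftrightarrow> (\<forall>K. compact K \<and> K \<subseteq> {0<..<1} \<longrightarrow> integrable (lebesgue_on K) f)"

definition has_weak_deriv :: "nat \<Rightarrow> (real \<Rightarrow> real) \<Rightarrow> (real \<Rightarrow> real) \<Rightarrow> bool" where
  "has_weak_deriv j f g \<longleftrightarrow>
     locally_integrable f \<and> locally_integrable g \<and>
     (\<forall>\<phi>. test_fun \<phi> \<longrightarrow>
        (\<integral>x. f x * (deriv ^^ j) \<phi> x \<partial>leb01) = (-1) ^ j * (\<integral>x. g x * \<phi> x \<partial>leb01))"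

text \<open>A weak derivative is determined up to null sets; \<open>weak_deriv\<close> selects a representative.\<close>

definition weak_deriv :: "nat \<Rightarrow> (real \<Rightarrow> real) \<Rightarrow> real \<Rightarrow> real" where
  "weak_deriv j f = (SOME g. has_weak_deriv j f g)"

definition sobolev :: "nat \<Rightarrow> ennreal \<Rightarrow> (real \<Rightarrow> real) set" where
  "sobolev r p = {f \<in> Lp_space p. \<forall>j\<le>r. \<exists>g\<in>Lp_space p. has_weak_deriv j f g}"

definition sobolev_norm :: "nat \<Rightarrow> ennreal \<Rightarrow> (real \<Rightarrow> real) \<Rightarrow> real" where
  "sobolev_norm r p f = Max ((\<lambda>j. Lp_norm p (weak_deriv j f)) ` {0..r})"

definition test_error :: "ennreal \<Rightarrow> ((real \<Rightarrow> real) \<Rightarrow> real \<Rightarrow> real) \<Rightarrow> real" where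
  "test_error p T = Max {
     Lp_norm p (\<lambda>x. T (e_fun 0) x - e_fun 0 x),
     Lp_norm p (\<lambda>x. T (e_fun 1) x - e_fun 1 x),
     Lp_norm p (\<lambda>x. T (\<lambda>t. - e_fun 1 t) x + e_fun 1 x),
     Lp_norm p (\<lambda>x. T (e_fun 2) x - e_fun 2 x)}"

end

theory Submission
  imports Defs
begin

text \<open>
  Testing the weak derivatives of \<open>f\<close> against smooth bumps, smoothed indicators of intervals and
  smoothed tents, and letting the smoothing parameter tend to 0, shows that with
  \<open>M = sobolev_norm 2 \<infinity> f\<close> one has \<open>\<bar>f\<bar> \<le> M\<close>, \<open>f\<close> is \<open>M\<close>-Lipschitz, and \<open>M / 2 * t\<^sup>2 \<plusminus> f t\<close> is convex
  on the open unit interval. Supporting lines at \<open>x\<close> give parabolas \<open>b + a * t + M / 2 * t\<^sup>2\<close> that dominate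
  \<open>\<plusminus> f\<close> and touch it at \<open>x\<close>, with \<open>\<bar>a\<bar> \<le> 2 * M\<close> and \<open>\<bar>b\<bar> \<le> 4 * M\<close>. Applying \<open>T\<close> to these inequalities bounds
  \<open>\<bar>f x - T f x\<bar>\<close> by \<open>7 * M\<close> times the largest of the four test errors at \<open>x\<close>, and since the maximum of four
  functions is controlled in \<open>L\<^sub>p\<close> by four times the largest norm, \<open>C = 28\<close> works. That the chosen
  weak derivatives are essentially bounded relies on their uniqueness up to null sets.
\<close>

section \<open>Smooth functions and a smooth ramp\<close>

definition smooth :: "(real \<Rightarrow> real) \<Rightarrow> bool" where
  "smooth f \<longleftrightarrow> (\<forall>n x. (deriv ^^ n) f differentiable (at x))"

text \<open>Iterated derivatives starting at \<open>f\<close> never leave \<open>S\<close>, and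
  every member of \<open>S\<close> is differentiable everywhere. Smoothness proofs thus reduce to
  naming a family that is closed under differentiation.\<close>

lemma smooth_coinduct:
  assumes "f \<in> S"
    and step: "\<And>f. f \<in> S \<Longrightarrow> \<exists>f'\<in>S. \<forall>x. (f has_real_derivative f' x) (at x)"
  shows "smooth f"
proof -
  have deriv_S: "deriv g \<in> S" if g: "g \<in> S" for g
  proof -
    obtain g' where g': "g' \<in> S" "\<And>x. (g has_real_derivative g' x) (at x)"
      using step[OF g] by blast
    then have "deriv g = g'"
      by (auto intro!: DERIV_imp_deriv)
    with g' show ?thesis by simp
  qed
  have "(deriv ^^ n) f \<in> S" for n
    by (induction n) (auto intro: assms(1) deriv_S)
  then show ?thesis
    unfolding smooth_def by (meson step real_differentiable_def)
qed

lemma smooth_has_deriv: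
  assumes "smooth f" shows "(f has_real_derivative deriv f x) (at x)"
proof -
  have "f differentiable (at x)"
    using assms[unfolded smooth_def, rule_format, of 0 x] by simp
  then show ?thesis
    by (auto simp: real_differentiable_def DERIV_imp_deriv)
qed

lemma smooth_deriv: "smooth f \<Longrightarrow> smooth (deriv f)"
  unfolding smooth_def by (metis funpow_simps_right(2) comp_apply)

lemma smooth_primitive:
  assumes "\<And>x. (F has_real_derivative f x) (at x)" "smooth f"
  shows "smooth F"
proof (rule smooth_coinduct[of _ "insert F {f. smooth f}"])
  fix g assume "g \<in> insert F {f. smooth f}"
  then have "g = F \<or> smooth g" by auto
  then show "\<exists>g'\<in>insert F {f. smooth f}. \<forall>x. (g has_real_derivative g' x) (at x)"
  proof
    assume "g = F" with assms show ?thesis by blast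
  next
    assume "smooth g" then show ?thesis by (auto intro: smooth_has_deriv smooth_deriv)
  qed
qed simp

lemma smooth_affine:
  assumes "smooth f" shows "smooth (\<lambda>x. f (a * x + b))"
\<comment> \<open>The free factor \<open>c\<close> absorbs the powers of \<open>a\<close> that the
  chain rule produces.\<close>
proof (rule smooth_coinduct[of _ "{\<lambda>x. c * f (a * x + b) |c f. smooth f}"])
  show "(\<lambda>x. f (a * x + b)) \<in> {\<lambda>x. c * f (a * x + b) |c f. smooth f}"
    using assms by (auto intro!: exI[of _ 1] exI[of _ f])
next
  fix g assume "g \<in> {\<lambda>x. c * f (a * x + b) |c f. smooth f}"
  then obtain c f where g: "g = (\<lambda>x. c * f (a * x + b))" "smooth f" by blast
  have "(g has_real_derivative c * a * deriv f (a * x + b)) (at x)" for x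
    unfolding g(1)
    by (rule derivative_eq_intros DERIV_chain2[OF smooth_has_deriv] g refl)+ simp
  moreover have "(\<lambda>x. c * a * deriv f (a * x + b)) \<in> {\<lambda>x. c * f (a * x + b) |c f. smooth f}"
    using smooth_deriv[OF g(2)] by blast
  ultimately show "\<exists>g'\<in>{\<lambda>x. c * f (a * x + b) |c f. smooth f}.
      \<forall>x. (g has_real_derivative g' x) (at x)" by (intro bexI allI)
qed

lemma smooth_lincomb:
  assumes "smooth f" "smooth g" shows "smooth (\<lambda>x. a * f x + b * g x)"
proof (rule smooth_coinduct[of _ "{\<lambda>x. a * f x + b * g x |f g. smooth f \<and> smooth g}"])
  fix h assume "h \<in> {\<lambda>x. a * f x + b * g x |f g. smooth f \<and> smooth g}"
  then obtain f g where h: "h = (\<lambda>x. a * f x + b * g x)" "smooth f" "smooth g" by blast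
  have "(h has_real_derivative a * deriv f x + b * deriv g x) (at x)" for x
    unfolding h(1) by (rule derivative_eq_intros smooth_has_deriv h refl)+ simp
  moreover have "(\<lambda>x. a * deriv f x + b * deriv g x) \<in> {\<lambda>x. a * f x + b * g x |f g. smooth f \<and> smooth g}"
    using smooth_deriv h by blast
  ultimately show "\<exists>h'\<in>{\<lambda>x. a * f x + b * g x |f g. smooth f \<and> smooth g}.
      \<forall>x. (h has_real_derivative h' x) (at x)" by (intro bexI allI)
qed (use assms in blast)

text \<open>Products alone are not closed under differentiation; by the product rule, finite sums of
  products are.\<close>

inductive_set product_sums :: "(real \<Rightarrow> real) set" where
  prod: "smooth f \<Longrightarrow> smooth g \<Longrightarrow> (\<lambda>x. f x * g x) \<in> product_sums"
| add: "f \<in> product_sums \<Longrightarrow> g \<in> product_sums \<Longrightarrow> (\<lambda>x. f x + g x) \<in> product_sums"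

lemma smooth_mult:
  assumes "smooth f" "smooth g" shows "smooth (\<lambda>x. f x * g x)"
proof (rule smooth_coinduct[of _ product_sums])
  fix h assume "h \<in> product_sums"
  then show "\<exists>h'\<in>product_sums. \<forall>x. (h has_real_derivative h' x) (at x)"
  proof induction
    case (prod f g)
    have "((\<lambda>x. f x * g x) has_real_derivative deriv f x * g x + f x * deriv g x) (at x)" for x
      by (rule derivative_eq_intros smooth_has_deriv prod refl)+ simp
    moreover have "(\<lambda>x. deriv f x * g x + f x * deriv g x) \<in> product_sums"
      by (intro product_sums.intros smooth_deriv prod)
    ultimately show ?case by (intro bexI allI)
  next
    case (add f g)
    then obtain f' g' where "f' \<in> product_sums" "g' \<in> product_sums"
      "\<And>x. (f has_real_derivative f' x) (at x)" "\<And>x. (g has_real_derivative g' x) (at x)"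
      by blast
    then show ?case
      by (intro bexI[of _ "\<lambda>x. f' x + g' x"]) (auto intro: DERIV_add product_sums.add)
  qed
qed (intro product_sums.prod assms)

section \<open>Flat exponentials and a smooth bump\<close>

definition flat_exp :: "real poly \<Rightarrow> real \<Rightarrow> real" where
  "flat_exp q x = (if x > 0 then poly q (1 / x) * exp (- (1 / x)) else 0)"

lemma poly_times_exp_tendsto_0: "((\<lambda>y. poly q y * exp (- y)) \<longlongrightarrow> (0::real)) at_top"
proof -
  have "((\<lambda>y. \<Sum>i\<le>degree q. coeff q i * (y ^ i / exp y)) \<longlongrightarrow> (\<Sum>i\<le>degree q. coeff q i * 0)) at_top"
    by (intro tendsto_intros tendsto_power_div_exp_0)
  then show ?thesis
    by (simp add: poly_altdef sum_distrib_right exp_minus divide_inverse mult.assoc)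
qed

text \<open>With y = 1/x, the derivative in x of q(y) exp(-y) is y^2 (q(y) - q'(y)) exp(-y), which
  has the same shape; hence the polynomial parameter of \<open>flat_exp\<close>. At 0 the
  exponential decay beats every polynomial in 1/x.\<close>

lemma flat_exp_has_deriv:
  "(flat_exp q has_real_derivative flat_exp (monom 1 2 * (q - pderiv q)) x) (at x)"
proof -
  consider "x < 0" | "x = 0" | "x > 0" by linarith
  then show ?thesis
  proof cases
    case 1
    have "((\<lambda>_. 0) has_real_derivative 0) (at x)" by simp
    moreover have "\<forall>\<^sub>F y in nhds x. flat_exp q y = 0"
      using eventually_nhds_in_open[of "{..<0}" x] 1
      by (auto simp: flat_exp_def elim!: eventually_mono)
    ultimately show ?thesis
      using 1 by (subst DERIV_cong_ev[OF refl _ refl, where g="\<lambda>_. 0"]) (auto simp: flat_exp_def)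
  next
    case 2
    have "((\<lambda>h. flat_exp q h / h) \<longlongrightarrow> 0) (at_right 0)"
    proof -
      \<comment> \<open>Dividing by \<open>h\<close> multiplies the polynomial in
        \<open>1 / h\<close> by its variable, which is what \<open>pCons 0 q\<close> does.\<close>
      have "((\<lambda>h. poly (pCons 0 q) (inverse h) * exp (- inverse h)) \<longlongrightarrow> 0) (at_right 0)"
        by (rule filterlim_compose[OF poly_times_exp_tendsto_0 filterlim_inverse_at_top_right])
      moreover have "\<forall>\<^sub>F h in at_right 0. poly (pCons 0 q) (inverse h) * exp (- inverse h) = flat_exp q h / h"
        using eventually_at_right_less[of "0::real"]
        by eventually_elim (simp add: flat_exp_def field_simps)
      ultimately show ?thesis by (rule Lim_transform_eventually)
    qed
    moreover have "((\<lambda>h. flat_exp q h / h) \<longlongrightarrow> 0) (at_left 0)"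
      by (rule tendsto_eventually) (auto simp: eventually_at_filter flat_exp_def)
    ultimately have "((\<lambda>h. flat_exp q h / h) \<longlongrightarrow> 0) (at 0)"
      by (simp add: filterlim_at_split)
    then show ?thesis
      using 2 by (simp add: DERIV_def flat_exp_def)
  next
    case 3
    have "((\<lambda>y. poly q (1 / y) * exp (- (1 / y))) has_real_derivative
        poly (monom 1 2 * (q - pderiv q)) (1 / x) * exp (- (1 / x))) (at x)"
      using 3 by (auto intro!: derivative_eq_intros DERIV_chain2[OF poly_DERIV]
          simp: poly_monom algebra_simps power2_eq_square)
    moreover have "\<forall>\<^sub>F y in nhds x. flat_exp q y = poly q (1 / y) * exp (- (1 / y))"
      using eventually_nhds_in_open[of "{0<..}" x] 3
      by (auto simp: flat_exp_def elim!: eventually_mono)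
    ultimately show ?thesis
      using 3 by (subst DERIV_cong_ev[OF refl _ refl]) (auto simp: flat_exp_def)
  qed
qed

lemma smooth_flat_exp: "smooth (flat_exp q)"
  by (rule smooth_coinduct[of _ "range flat_exp"]) (auto intro: flat_exp_has_deriv)

lemma smooth_continuous: "smooth f \<Longrightarrow> continuous_on S f"
  by (meson DERIV_isCont continuous_at_imp_continuous_on smooth_has_deriv)

lemma smooth_bump_exists:
  "\<exists>\<rho>. smooth \<rho> \<and> (\<forall>x. \<rho> x \<ge> 0) \<and> (\<forall>x. x \<in> {0<..<1} \<longrightarrow> \<rho> x > 0) \<and> (\<forall>x. x \<notin> {0<..<1} \<longrightarrow> \<rho> x = 0)"
proof (intro exI conjI allI impI)
  \<comment> \<open>The first factor vanishes for \<open>x \<le> 0\<close>, the reflected one for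
    \<open>x \<ge> 1\<close>.\<close>
  let ?\<rho> = "\<lambda>x. flat_exp 1 x * flat_exp 1 ((-1) * x + 1)"
  show "smooth ?\<rho>"
    by (intro smooth_mult smooth_affine smooth_flat_exp)
qed (auto simp: flat_exp_def)

lemma smooth_primitive_exists:
  assumes "smooth f" shows "\<exists>F. \<forall>x. (F has_real_derivative f x) (at x)"
  using einterval_antiderivative[of "-\<infinity>" \<infinity> f] DERIV_isCont[OF smooth_has_deriv[OF assms]]
  by (auto simp: has_real_derivative_iff_has_vector_derivative)

text \<open>\<open>r\<close> is a bump of mass 1, \<open>H\<close> a smoothed Heaviside function and
  \<open>\<Theta>\<close> a smoothed positive part. Right of 1 the latter differs from
  \<open>x\<close> by an offset \<open>\<kappa>\<close> that depends on the shape of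
  \<open>r\<close>.\<close>

locale smooth_ramp =
  fixes r H \<Theta> :: "real \<Rightarrow> real" and \<kappa> :: real
  assumes smooth_r: "smooth r"
    and r_nonneg: "r x \<ge> 0"
    and r_eq_0: "x \<notin> {0<..<1} \<Longrightarrow> r x = 0"
    and H_deriv: "(H has_real_derivative r x) (at x)"
    and H_left: "x \<le> 0 \<Longrightarrow> H x = 0"
    and H_right: "x \<ge> 1 \<Longrightarrow> H x = 1"
    and mono_H: "mono H"
    and \<Theta>_deriv: "(\<Theta> has_real_derivative H x) (at x)"
    and \<Theta>_left: "x \<le> 0 \<Longrightarrow> \<Theta> x = 0"
    and \<Theta>_right: "x \<ge> 1 \<Longrightarrow> \<Theta> x = x + \<kappa>"
    and convex_\<Theta>: "convex_on UNIV \<Theta>"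

lemma smooth_ramp_exists: "\<exists>r H \<Theta> \<kappa>. smooth_ramp r H \<Theta> \<kappa>"
proof -
  obtain \<rho> where \<rho>: "smooth \<rho>" "\<And>x. \<rho> x \<ge> 0" "\<And>x. 0 < x \<Longrightarrow> x < 1 \<Longrightarrow> \<rho> x > 0"
      "\<And>x. x \<notin> {0<..<1} \<Longrightarrow> \<rho> x = 0"
    using smooth_bump_exists by fastforce
  obtain F where F: "\<And>x. (F has_real_derivative \<rho> x) (at x)"
    using smooth_primitive_exists[OF \<rho>(1)] by blast
  \<comment> \<open>Strict positivity inside the interval gives the bump positive mass, so that it
    can be normalized.\<close>
  have "F 0 < F 1"
    by (rule DERIV_pos_imp_increasing_open)
      (use F \<rho>(3) in \<open>auto intro!: DERIV_isCont continuous_at_imp_continuous_on\<close>)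
  define r where "r = (\<lambda>x. \<rho> x / (F 1 - F 0))"
  define H where "H = (\<lambda>x. (F x - F 0) / (F 1 - F 0))"
  have r: "smooth r" "\<And>x. r x \<ge> 0" "\<And>x. x \<notin> {0<..<1} \<Longrightarrow> r x = 0"
    using smooth_lincomb[OF \<rho>(1) \<rho>(1), of "1 / (F 1 - F 0)" 0] \<rho>(2,4) \<open>F 0 < F 1\<close>
    by (auto simp: r_def)
  have H': "(H has_real_derivative r x) (at x)" for x
    unfolding H_def r_def using \<open>F 0 < F 1\<close> by (auto intro!: derivative_eq_intros F)
  have const: "f x = f y" if "x \<le> y" "\<And>t. (f has_real_derivative g t) (at t)"
      "\<And>t. x < t \<Longrightarrow> t < y \<Longrightarrow> g t = 0" for f g :: "real \<Rightarrow> real" and x y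
  proof (cases "x = y")
    case False
    have "continuous_on {x..y} f"
      using that(2) by (auto intro!: DERIV_isCont continuous_at_imp_continuous_on)
    moreover have "(f has_real_derivative 0) (at t)" if "x < t" "t < y" for t
      using \<open>\<And>t. (f has_real_derivative g t) (at t)\<close>[of t] \<open>\<And>t. x < t \<Longrightarrow> t < y \<Longrightarrow> g t = 0\<close>[OF that]
      by simp
    ultimately show ?thesis
      using False \<open>x \<le> y\<close> DERIV_isconst2[of x y f y] by force
  qed simp
  have H0: "H x = 0" if "x \<le> 0" for x
    using const[OF that H'] r(3) \<open>F 0 < F 1\<close> by (simp add: H_def)
  have H1: "H x = 1" if "x \<ge> 1" for x
    using const[OF that H'] r(3) \<open>F 0 < F 1\<close> by (simp add: H_def)
  have smooth_H: "smooth H" by (rule smooth_primitive[OF H' r(1)])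
  have "mono H"
    using DERIV_nonneg_imp_nondecreasing[where f = H] H' r(2) by (meson monoI)
  obtain G where G: "\<And>x. (G has_real_derivative H x) (at x)"
    using smooth_primitive_exists[OF smooth_H] by blast
  define \<Theta> where "\<Theta> = (\<lambda>x. G x - G 0)"
  have \<Theta>': "(\<Theta> has_real_derivative H x) (at x)" for x
    unfolding \<Theta>_def by (auto intro!: derivative_eq_intros G)
  have "\<Theta> x = 0" if "x \<le> 0" for x
    using const[OF that \<Theta>'] H0 by (simp add: \<Theta>_def)
  moreover have "\<Theta> x = x + (\<Theta> 1 - 1)" if "x \<ge> 1" for x
  proof -
    \<comment> \<open>Right of 1 the slope of \<open>\<Theta>\<close> is 1, so subtracting
      \<open>x\<close> leaves a constant, namely \<open>\<Theta> 1 - 1\<close>.\<close>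
    have "((\<lambda>x. \<Theta> x - x) has_real_derivative H t - 1) (at t)" for t
      by (auto intro!: derivative_eq_intros \<Theta>')
    from const[OF that this] show ?thesis by (simp add: H1)
  qed
  moreover have "convex_on UNIV \<Theta>"
    by (rule convex_on_realI[of _ _ H]) (use \<Theta>' \<open>mono H\<close> in \<open>auto simp: monoD\<close>)
  ultimately have "smooth_ramp r H \<Theta> (\<Theta> 1 - 1)"
    using r H' H0 H1 \<open>mono H\<close> \<Theta>' by unfold_locales blast+
  then show ?thesis by blast
qed

section \<open>Test functions\<close>

lemma integrable_leb01_continuous:
  fixes f :: "real \<Rightarrow> real"
  shows "continuous_on {0..1} f \<Longrightarrow> integrable leb01 f"
  using continuous_imp_integrable[of 0 1 f] by simp

lemma leb01_FTC:
  assumes "\<And>x. (F has_real_derivative f x) (at x)" "continuous_on {0..1} f"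
  shows "(\<integral>x. f x \<partial>leb01) = F 1 - F 0"
proof -
  have "(f has_integral F 1 - F 0) {0..1}"
    by (rule fundamental_theorem_of_calculus)
      (use assms in \<open>auto simp: has_real_derivative_iff_has_vector_derivative
        intro: has_vector_derivative_at_within\<close>)
  then show ?thesis
    using lebesgue_integral_eq_integral[OF integrable_leb01_continuous[OF assms(2)]]
    by (simp add: integral_unique)
qed

lemma test_funI:
  assumes "smooth \<phi>" "0 < a" "b < 1" "\<And>x. x \<notin> {a..b} \<Longrightarrow> \<phi> x = 0"
  shows "test_fun \<phi>"
proof -
  have "closure {x. \<phi> x \<noteq> 0} \<subseteq> {a..b}"
    by (rule closure_minimal) (use assms(4) in \<open>force+\<close>)
  then show ?thesis
    using assms by (force simp: test_fun_def smooth_def)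
qed

lemma test_fun_smooth: "test_fun \<phi> \<Longrightarrow> smooth \<phi>"
  by (simp add: test_fun_def smooth_def)

text \<open>Every estimate on \<open>f\<close> comes from this inequality: if the derivative of
  order \<open>j\<close> of \<open>\<phi>\<close> approximates a combination of point masses, the
  left side approximates the same combination of values of \<open>f\<close>. As
  \<open>\<phi>\<close> is nonnegative, the right side contains no absolute value and can be
  computed.\<close>

lemma weak_deriv_integral_bound:
  assumes "has_weak_deriv j f g" "AE x in leb01. \<bar>g x\<bar> \<le> M" "test_fun \<phi>" "\<And>x. \<phi> x \<ge> 0"
  shows "\<bar>\<integral>x. f x * (deriv ^^ j) \<phi> x \<partial>leb01\<bar> \<le> M * (\<integral>x. \<phi> x \<partial>leb01)"
proof -
  have int: "integrable leb01 \<phi>"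
    by (intro integrable_leb01_continuous smooth_continuous test_fun_smooth assms)
  have bound: "AE x in leb01. \<bar>g x * \<phi> x\<bar> \<le> M * \<phi> x"
    using assms(2)
    by eventually_elim (use assms(4) in \<open>simp add: abs_mult mult_right_mono\<close>)
  have "\<bar>\<integral>x. f x * (deriv ^^ j) \<phi> x \<partial>leb01\<bar> = \<bar>\<integral>x. g x * \<phi> x \<partial>leb01\<bar>"
    using assms by (simp add: has_weak_deriv_def abs_mult)
  also have "\<dots> \<le> (\<integral>x. \<bar>g x * \<phi> x\<bar> \<partial>leb01)"
    by (rule integral_abs_bound)
  also have "\<dots> \<le> (\<integral>x. M * \<phi> x \<partial>leb01)"
    \<comment> \<open>Only the majorant has to be integrable here; a nonintegrable function has
      integral 0, which the nonnegative majorant dominates as well.\<close>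
    using bound by (intro integral_mono_AE') (auto intro: int elim!: eventually_mono)
  finally show ?thesis by simp
qed

section \<open>Smoothed point masses, indicators and tents\<close>

context smooth_ramp
begin

text \<open>As \<open>\<epsilon>\<close> decreases to 0, \<open>kernel\<close> tends to the unit
  point mass at \<open>c\<close>, \<open>step\<close> to the indicator of the points above
  \<open>c\<close>, and \<open>ramp\<close> to the positive part of \<open>x - c\<close>; each is
  the derivative of the next. All smoothing happens on \<open>{c..c + \<epsilon>}\<close>, to the
  right of \<open>c\<close>, hence conditions such as \<open>c + \<epsilon> < 1\<close>.\<close>

definition kernel :: "real \<Rightarrow> real \<Rightarrow> real \<Rightarrow> real" where
  "kernel \<epsilon> c x = r ((x - c) / \<epsilon>) / \<epsilon>"

definition step :: "real \<Rightarrow> real \<Rightarrow> real \<Rightarrow> real" where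
  "step \<epsilon> c x = H ((x - c) / \<epsilon>)"

definition ramp :: "real \<Rightarrow> real \<Rightarrow> real \<Rightarrow> real" where
  "ramp \<epsilon> c x = \<epsilon> * \<Theta> ((x - c) / \<epsilon>)"

lemma ramp_deriv: "\<epsilon> \<noteq> 0 \<Longrightarrow> (ramp \<epsilon> c has_real_derivative step \<epsilon> c x) (at x)"
  unfolding ramp_def step_def
  by (auto intro!: derivative_eq_intros DERIV_chain2[OF \<Theta>_deriv])

lemma step_deriv: "\<epsilon> \<noteq> 0 \<Longrightarrow> (step \<epsilon> c has_real_derivative kernel \<epsilon> c x) (at x)"
  unfolding step_def kernel_def
  by (rule DERIV_cong, rule DERIV_chain2[OF H_deriv]) (auto intro!: derivative_eq_intros)

lemma smooth_kernel: "smooth (kernel \<epsilon> c)"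
proof -
  have "smooth (\<lambda>x. r ((1 / \<epsilon>) * x + (- c / \<epsilon>)))"
    by (rule smooth_affine[OF smooth_r])
  from smooth_lincomb[OF this this, of "1 / \<epsilon>" 0] show ?thesis
    by (simp add: kernel_def[abs_def] diff_divide_distrib)
qed

lemma smooth_step: "\<epsilon> \<noteq> 0 \<Longrightarrow> smooth (step \<epsilon> c)"
  using smooth_primitive step_deriv smooth_kernel by blast

lemma kernel_nonneg: "\<epsilon> > 0 \<Longrightarrow> kernel \<epsilon> c x \<ge> 0"
  by (simp add: kernel_def r_nonneg)

lemma kernel_eq_0: "\<epsilon> > 0 \<Longrightarrow> x \<notin> {c..c + \<epsilon>} \<Longrightarrow> kernel \<epsilon> c x = 0"
  by (auto simp: kernel_def field_simps intro!: r_eq_0)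

lemma step_left: "\<epsilon> > 0 \<Longrightarrow> x \<le> c \<Longrightarrow> step \<epsilon> c x = 0"
  by (auto simp: step_def field_simps intro!: H_left)

lemma step_right: "\<epsilon> > 0 \<Longrightarrow> x \<ge> c + \<epsilon> \<Longrightarrow> step \<epsilon> c x = 1"
  by (auto simp: step_def field_simps intro!: H_right)

lemma ramp_left: "\<epsilon> > 0 \<Longrightarrow> x \<le> c \<Longrightarrow> ramp \<epsilon> c x = 0"
  by (auto simp: ramp_def field_simps intro!: \<Theta>_left)

lemma ramp_right: 
  assumes "\<epsilon> > 0" "x \<ge> c + \<epsilon>" shows "ramp \<epsilon> c x = x - c + \<epsilon> * \<kappa>"
proof -
  have "(x - c) / \<epsilon> \<ge> 1" using assms by (simp add: field_simps)
  from \<Theta>_right[OF this] assms show ?thesis by (simp add: ramp_def field_simps)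
qed

lemmas continuous_kernel [continuous_intros] = smooth_continuous[OF smooth_kernel]

lemma test_fun_kernel:
  "\<epsilon> > 0 \<Longrightarrow> 0 < c \<Longrightarrow> c + \<epsilon> < 1 \<Longrightarrow> test_fun (kernel \<epsilon> c)"
  by (rule test_funI[OF smooth_kernel, of c "c + \<epsilon>"]) (auto intro: kernel_eq_0)

text \<open>A smoothed indicator of \<open>{c<..d}\<close>, whose derivative tends to the difference
  of the point masses at \<open>c\<close> and \<open>d\<close>.\<close>

definition plateau :: "real \<Rightarrow> real \<Rightarrow> real \<Rightarrow> real \<Rightarrow> real" where
  "plateau \<epsilon> c d x = step \<epsilon> c x - step \<epsilon> d x"

lemma plateau_eq_0: "\<epsilon> > 0 \<Longrightarrow> c \<le> d \<Longrightarrow> x \<notin> {c..d + \<epsilon>} \<Longrightarrow> plateau \<epsilon> c d x = 0"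
  by (cases "x < c") (auto simp: plateau_def step_left step_right)

lemma plateau_deriv:
  "\<epsilon> \<noteq> 0 \<Longrightarrow> (plateau \<epsilon> c d has_real_derivative kernel \<epsilon> c x - kernel \<epsilon> d x) (at x)"
  unfolding plateau_def by (auto intro!: derivative_eq_intros step_deriv)

lemma step_antimono: "\<epsilon> > 0 \<Longrightarrow> c \<le> d \<Longrightarrow> step \<epsilon> d x \<le> step \<epsilon> c x"
  unfolding step_def by (intro monoD[OF mono_H] divide_right_mono) auto

lemma plateau_nonneg: "\<epsilon> > 0 \<Longrightarrow> c \<le> d \<Longrightarrow> plateau \<epsilon> c d x \<ge> 0"
  by (simp add: plateau_def step_antimono)

lemma smooth_plateau: "\<epsilon> \<noteq> 0 \<Longrightarrow> smooth (plateau \<epsilon> c d)"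
  unfolding plateau_def[abs_def]
  using smooth_lincomb[OF smooth_step smooth_step, of \<epsilon> \<epsilon> 1 c "-1" d] by simp

lemma test_fun_plateau:
  "\<epsilon> > 0 \<Longrightarrow> 0 < c \<Longrightarrow> c \<le> d \<Longrightarrow> d + \<epsilon> < 1 \<Longrightarrow> test_fun (plateau \<epsilon> c d)"
  by (rule test_funI[of _ c "d + \<epsilon>"]) (auto intro: plateau_eq_0 smooth_plateau)

text \<open>
  The weights and the middle node are chosen so that the affine pieces of the three ramps cancel to
  the right of \<open>d + \<epsilon>\<close>; hence the tent has compact support.
\<close>

definition tent :: "real \<Rightarrow> real \<Rightarrow> real \<Rightarrow> real \<Rightarrow> real \<Rightarrow> real" where
  "tent \<epsilon> l c d x = (1 - l) * ramp \<epsilon> c x - ramp \<epsilon> ((1 - l) * c + l * d) x + l * ramp \<epsilon> d x"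

definition tent' :: "real \<Rightarrow> real \<Rightarrow> real \<Rightarrow> real \<Rightarrow> real \<Rightarrow> real" where
  "tent' \<epsilon> l c d x = (1 - l) * step \<epsilon> c x - step \<epsilon> ((1 - l) * c + l * d) x + l * step \<epsilon> d x"

definition tent'' :: "real \<Rightarrow> real \<Rightarrow> real \<Rightarrow> real \<Rightarrow> real \<Rightarrow> real" where
  "tent'' \<epsilon> l c d x = (1 - l) * kernel \<epsilon> c x - kernel \<epsilon> ((1 - l) * c + l * d) x + l * kernel \<epsilon> d x"

lemma tent_deriv: "\<epsilon> \<noteq> 0 \<Longrightarrow> (tent \<epsilon> l c d has_real_derivative tent' \<epsilon> l c d x) (at x)"
  unfolding tent_def[abs_def] tent'_def by (auto intro!: derivative_eq_intros ramp_deriv)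

lemma tent'_deriv: "\<epsilon> \<noteq> 0 \<Longrightarrow> (tent' \<epsilon> l c d has_real_derivative tent'' \<epsilon> l c d x) (at x)"
  unfolding tent'_def[abs_def] tent''_def by (auto intro!: derivative_eq_intros step_deriv)

lemma smooth_tent'':  "smooth (tent'' \<epsilon> l c d)"
  using smooth_lincomb[OF smooth_lincomb[OF smooth_kernel smooth_kernel] smooth_kernel,
      of "1" "1 - l" \<epsilon> c "-1" \<epsilon> "(1 - l) * c + l * d" l \<epsilon> d]
  by (simp add: tent''_def[abs_def])

lemma smooth_tent': "\<epsilon> \<noteq> 0 \<Longrightarrow> smooth (tent' \<epsilon> l c d)"
  using smooth_primitive tent'_deriv smooth_tent'' by blast

lemma smooth_tent: "\<epsilon> \<noteq> 0 \<Longrightarrow> smooth (tent \<epsilon> l c d)"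
  using smooth_primitive tent_deriv smooth_tent' by blast

lemma tent_eq_0:
  assumes "\<epsilon> > 0" "c \<le> d" "0 \<le> l" "l \<le> 1" "x \<notin> {c..d + \<epsilon>}"
  shows "tent \<epsilon> l c d x = 0" "tent' \<epsilon> l c d x = 0"
proof -
  define m where "m = (1 - l) * c + l * d"
  have m: "c \<le> m" "m \<le> d"
    using convex_bound_le[of c d d "1 - l" l] convex_bound_le[of "-c" "-c" "-d" "1 - l" l] assms
    by (auto simp: m_def algebra_simps mult_left_mono)
  have "x < c \<or> x > d + \<epsilon>" using assms by auto
  then show "tent' \<epsilon> l c d x = 0"
    using m assms by (auto simp: tent'_def m_def[symmetric] step_left step_right)
  from \<open>x < c \<or> x > d + \<epsilon>\<close> show "tent \<epsilon> l c d x = 0"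
  proof
    assume "x > d + \<epsilon>"
    then have "tent \<epsilon> l c d x = (1 - l) * (x - c + \<epsilon> * \<kappa>) - (x - m + \<epsilon> * \<kappa>) + l * (x - d + \<epsilon> * \<kappa>)"
      using m assms by (simp add: tent_def m_def[symmetric] ramp_right)
    then show ?thesis by (simp add: m_def algebra_simps)
  qed (use m assms in \<open>auto simp: tent_def m_def[symmetric] ramp_left\<close>)
qed

text \<open>The middle node is the convex combination of \<open>c\<close> and \<open>d\<close> with
  the weights of the outer ramps, so this is Jensen's inequality for the convex
  \<open>\<Theta>\<close>.\<close>

lemma tent_nonneg:
  assumes "\<epsilon> > 0" "0 \<le> l" "l \<le> 1" shows "tent \<epsilon> l c d x \<ge> 0"
proof -
  have "\<Theta> ((1 - l) *\<^sub>R ((x - c) / \<epsilon>) + l *\<^sub>R ((x - d) / \<epsilon>))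
      \<le> (1 - l) * \<Theta> ((x - c) / \<epsilon>) + l * \<Theta> ((x - d) / \<epsilon>)"
    by (rule convex_onD[OF convex_\<Theta>]) (use assms in auto)
  moreover have "(1 - l) *\<^sub>R ((x - c) / \<epsilon>) + l *\<^sub>R ((x - d) / \<epsilon>) = (x - ((1 - l) * c + l * d)) / \<epsilon>"
    using assms by (simp add: field_simps)
  ultimately have "\<epsilon> * \<Theta> ((x - ((1 - l) * c + l * d)) / \<epsilon>)
      \<le> \<epsilon> * ((1 - l) * \<Theta> ((x - c) / \<epsilon>) + l * \<Theta> ((x - d) / \<epsilon>))"
    using assms by (intro mult_left_mono) auto
  then show ?thesis by (simp add: tent_def ramp_def algebra_simps)
qed

lemma test_fun_tent:
  assumes "\<epsilon> > 0" "0 < c" "c \<le> d" "d + \<epsilon> < 1" "0 \<le> l" "l \<le> 1"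
  shows "test_fun (tent \<epsilon> l c d)"
  by (rule test_funI[of _ c "d + \<epsilon>"]) (use assms in \<open>auto intro: tent_eq_0 smooth_tent\<close>)

lemma kernel_integral:
  assumes "\<epsilon> > 0" "0 < c" "c + \<epsilon> < 1" shows "(\<integral>x. kernel \<epsilon> c x \<partial>leb01) = 1"
  using leb01_FTC[of "step \<epsilon> c" "kernel \<epsilon> c"] assms
  by (simp add: step_deriv smooth_continuous smooth_kernel step_left step_right)

text \<open>Integration by parts against \<open>x\<close>. The mass of the plateau becomes a
  difference of first moments of kernels, so its limit is an instance of the limit that serves for
  \<open>f\<close>.\<close>

lemma plateau_integral:
  assumes "\<epsilon> > 0" "0 < c" "c \<le> d" "d + \<epsilon> < 1"
  shows "(\<integral>x. plateau \<epsilon> c d x \<partial>leb01) = - (\<integral>x. x * (kernel \<epsilon> c x - kernel \<epsilon> d x) \<partial>leb01)"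
proof -
  let ?g = "\<lambda>x. plateau \<epsilon> c d x + x * (kernel \<epsilon> c x - kernel \<epsilon> d x)"
  have cont: "continuous_on {0..1} (plateau \<epsilon> c d)"
      "continuous_on {0..1} (\<lambda>x. x * (kernel \<epsilon> c x - kernel \<epsilon> d x))"
    using assms by (auto intro!: continuous_intros intro: smooth_continuous smooth_plateau)
  have "(\<integral>x. ?g x \<partial>leb01) = 1 * plateau \<epsilon> c d 1 - 0 * plateau \<epsilon> c d 0"
    using assms cont
    by (intro leb01_FTC[of "\<lambda>x. x * plateau \<epsilon> c d x"])
      (auto intro!: derivative_eq_intros plateau_deriv continuous_intros)
  also have "\<dots> = 0" using assms by (simp add: plateau_eq_0)
  finally show ?thesis
    using integrable_leb01_continuous[OF cont(1)] integrable_leb01_continuous[OF cont(2)] by simp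
qed

text \<open>Two integrations by parts against \<open>x\<^sup>2 / 2\<close>, merged into the single
  primitive \<open>?G\<close>; the tent and its derivative vanish at 0 and 1, which removes the
  boundary terms.\<close>

lemma tent_integral:
  assumes "\<epsilon> > 0" "0 < c" "c \<le> d" "d + \<epsilon> < 1" "0 \<le> l" "l \<le> 1"
  shows "(\<integral>x. tent \<epsilon> l c d x \<partial>leb01) = (\<integral>x. x\<^sup>2 / 2 * tent'' \<epsilon> l c d x \<partial>leb01)"
proof -
  let ?g = "\<lambda>x. x\<^sup>2 / 2 * tent'' \<epsilon> l c d x - tent \<epsilon> l c d x"
  let ?G = "\<lambda>x. x\<^sup>2 / 2 * tent' \<epsilon> l c d x - x * tent \<epsilon> l c d x"
  have cont: "continuous_on {0..1} (tent \<epsilon> l c d)"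
      "continuous_on {0..1} (\<lambda>x. x\<^sup>2 / 2 * tent'' \<epsilon> l c d x)"
    using assms by (auto simp: tent''_def intro!: continuous_intros intro: smooth_continuous smooth_tent)
  have "(\<integral>x. ?g x \<partial>leb01) = ?G 1 - ?G 0"
    using assms cont smooth_continuous[OF smooth_tent'']
    by (intro leb01_FTC)
      (auto intro!: derivative_eq_intros tent_deriv tent'_deriv continuous_intros simp: field_simps)
  also have "\<dots> = 0" using assms by (simp add: tent_eq_0)
  finally show ?thesis
    using integrable_leb01_continuous[OF cont(1)] integrable_leb01_continuous[OF cont(2)] by simp
qed

lemma kernel_tendsto:
  assumes f: "continuous_on {0..1} f" and c: "0 < c" "c < 1"
  shows "((\<lambda>\<epsilon>. \<integral>x. f x * kernel \<epsilon> c x \<partial>leb01) \<longlongrightarrow> f c) (at_right 0)"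
proof (rule tendstoI)
  fix \<eta> :: real assume "\<eta> > 0"
  obtain \<delta> where \<delta>: "\<delta> > 0" "\<And>x. x \<in> {0..1} \<Longrightarrow> dist x c < \<delta> \<Longrightarrow> dist (f x) (f c) < \<eta> / 2"
    using f[unfolded continuous_on_iff, rule_format, of c "\<eta> / 2"] c \<open>\<eta> > 0\<close> by force
  \<comment> \<open>\<open>\<epsilon> < \<delta>\<close> keeps the kernel where \<open>f\<close> is
    close to \<open>f c\<close>, and \<open>\<epsilon> < 1 - c\<close> keeps its whole unit mass
    inside the interval.\<close>
  have "\<forall>\<^sub>F \<epsilon> in at_right 0. \<epsilon> \<in> {0<..<min \<delta> (1 - c)}"
    using \<delta> c by (intro eventually_at_right_real) auto
  then show "\<forall>\<^sub>F \<epsilon> in at_right 0. dist (\<integral>x. f x * kernel \<epsilon> c x \<partial>leb01) (f c) < \<eta>"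
  proof eventually_elim
    case (elim \<epsilon>)
    then have \<epsilon>: "\<epsilon> > 0" "\<epsilon> < \<delta>" "c + \<epsilon> < 1" by auto
    have int: "integrable leb01 (\<lambda>x. f x * kernel \<epsilon> c x)"
        "integrable leb01 (\<lambda>x. a * kernel \<epsilon> c x)" for a
      by (intro integrable_leb01_continuous continuous_intros f)+
    have "(\<integral>x. f x * kernel \<epsilon> c x \<partial>leb01) - f c
        = (\<integral>x. f x * kernel \<epsilon> c x - f c * kernel \<epsilon> c x \<partial>leb01)"
      using int kernel_integral[OF \<epsilon>(1) c(1) \<epsilon>(3)] by simp
    then have "\<bar>(\<integral>x. f x * kernel \<epsilon> c x \<partial>leb01) - f c\<bar> \<le> (\<integral>x. \<bar>f x * kernel \<epsilon> c x - f c * kernel \<epsilon> c x\<bar> \<partial>leb01)"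
      by (simp only: integral_abs_bound)
    also have "\<dots> \<le> (\<integral>x. \<eta> / 2 * kernel \<epsilon> c x \<partial>leb01)"
    proof (rule integral_mono)
      fix x assume "x \<in> space leb01"
      then have x: "x \<in> {0..1}" by simp
      show "\<bar>f x * kernel \<epsilon> c x - f c * kernel \<epsilon> c x\<bar> \<le> \<eta> / 2 * kernel \<epsilon> c x"
      proof (cases "x \<in> {c..c + \<epsilon>}")
        case True
        then have "dist x c < \<delta>"
          using \<epsilon> by (simp add: dist_real_def)
        from \<delta>(2)[OF x this] have "\<bar>f x - f c\<bar> \<le> \<eta> / 2"
          by (simp add: dist_real_def)
        then have "\<bar>f x - f c\<bar> * kernel \<epsilon> c x \<le> \<eta> / 2 * kernel \<epsilon> c x"
          by (intro mult_right_mono kernel_nonneg \<epsilon>)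
        moreover have "kernel \<epsilon> c x \<ge> 0" by (rule kernel_nonneg[OF \<epsilon>(1)])
        ultimately show ?thesis
          by (metis abs_mult abs_of_nonneg left_diff_distrib)
      qed (simp add: kernel_eq_0 \<epsilon>)
    qed (intro integrable_abs Bochner_Integration.integrable_diff int)+
    also have "\<dots> = \<eta> / 2"
      using kernel_integral[OF \<epsilon>(1) c(1) \<epsilon>(3)] by simp
    finally show ?case
      using \<open>\<eta> > 0\<close> by (simp add: dist_real_def)
  qed
qed

end

section \<open>Bounds on a function from its weak derivatives\<close>

context smooth_ramp
begin

text \<open>The Sobolev norm sees a weak derivative of order 0, not \<open>f\<close> itself. Testing
  against kernels and continuity of \<open>f\<close> turn the almost everywhere bound into one at
  each interior point.\<close>

lemma weak_deriv_0_bound: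
  assumes wd: "has_weak_deriv 0 f g" and M: "AE x in leb01. \<bar>g x\<bar> \<le> M"
    and f: "continuous_on {0..1} f" and c: "0 < c" "c < 1"
  shows "\<bar>f c\<bar> \<le> M"
proof (rule tendsto_le)
  show "((\<lambda>\<epsilon>. \<bar>\<integral>x. f x * kernel \<epsilon> c x \<partial>leb01\<bar>) \<longlongrightarrow> \<bar>f c\<bar>) (at_right 0)"
    by (intro tendsto_intros kernel_tendsto f c)
  have "((\<lambda>\<epsilon>. M * (\<integral>x. 1 * kernel \<epsilon> c x \<partial>leb01)) \<longlongrightarrow> M * 1) (at_right 0)"
    by (intro tendsto_intros kernel_tendsto c continuous_intros)
  then show "((\<lambda>\<epsilon>. M * (\<integral>x. kernel \<epsilon> c x \<partial>leb01)) \<longlongrightarrow> M) (at_right 0)" by simp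
  have "\<forall>\<^sub>F \<epsilon> in at_right 0. \<epsilon> \<in> {0<..<1 - c}"
    using c by (intro eventually_at_right_real) auto
  then show "\<forall>\<^sub>F \<epsilon> in at_right 0. \<bar>\<integral>x. f x * kernel \<epsilon> c x \<partial>leb01\<bar> \<le> M * (\<integral>x. kernel \<epsilon> c x \<partial>leb01)"
  proof eventually_elim
    case (elim \<epsilon>)
    then show ?case
      using weak_deriv_integral_bound[OF wd M test_fun_kernel kernel_nonneg] c by simp
  qed
qed simp

text \<open>Plateaus are tested: their derivatives pick out \<open>f c - f d\<close> in the limit,
  while their masses tend to \<open>d - c\<close>.\<close>

lemma weak_deriv_1_bound:
  assumes wd: "has_weak_deriv 1 f g" and M: "AE x in leb01. \<bar>g x\<bar> \<le> M"
    and f: "continuous_on {0..1} f" and cd: "0 < c" "c \<le> d" "d < 1"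
  shows "\<bar>f c - f d\<bar> \<le> M * (d - c)"
proof (rule tendsto_le)
  define A where "A = (\<lambda>f c \<epsilon>. \<integral>x. f x * kernel \<epsilon> c x \<partial>leb01)"
  have A: "(A f c \<longlongrightarrow> f c) (at_right 0)" if "continuous_on {0..1} f" "0 < c" "c < 1" for f c
    unfolding A_def by (rule kernel_tendsto[OF that])
  have diff: "(\<integral>x. f x * (kernel \<epsilon> c x - kernel \<epsilon> d x) \<partial>leb01) = A f c \<epsilon> - A f d \<epsilon>"
    if "continuous_on {0..1} f" for f \<epsilon>
    unfolding A_def right_diff_distrib
    by (rule Bochner_Integration.integral_diff)
      (auto intro!: integrable_leb01_continuous continuous_intros that)
  show "((\<lambda>\<epsilon>. \<bar>A f c \<epsilon> - A f d \<epsilon>\<bar>) \<longlongrightarrow> \<bar>f c - f d\<bar>) (at_right 0)"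
    by (intro tendsto_intros A f) (use cd in auto)
  show "((\<lambda>\<epsilon>. M * (A (\<lambda>x. x) d \<epsilon> - A (\<lambda>x. x) c \<epsilon>)) \<longlongrightarrow> M * (d - c)) (at_right 0)"
    by (intro tendsto_intros A continuous_intros) (use cd in auto)
  have "\<forall>\<^sub>F \<epsilon> in at_right 0. \<epsilon> \<in> {0<..<1 - d}"
    using cd by (intro eventually_at_right_real) auto
  then show "\<forall>\<^sub>F \<epsilon> in at_right 0. \<bar>A f c \<epsilon> - A f d \<epsilon>\<bar> \<le> M * (A (\<lambda>x. x) d \<epsilon> - A (\<lambda>x. x) c \<epsilon>)"
  proof eventually_elim
    case (elim \<epsilon>)
    then have \<epsilon>: "\<epsilon> > 0" "d + \<epsilon> < 1" by auto
    have "deriv (plateau \<epsilon> c d) = (\<lambda>x. kernel \<epsilon> c x - kernel \<epsilon> d x)"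
      using \<epsilon> by (intro ext DERIV_imp_deriv plateau_deriv) simp
    then show ?case
      using weak_deriv_integral_bound[OF wd M test_fun_plateau plateau_nonneg, of \<epsilon> c d] cd \<epsilon>
      by (simp add: diff f plateau_integral)
  qed
qed simp

text \<open>Tents are tested. The right side is \<open>M\<close> times the left-hand expression for
  \<open>x\<^sup>2 / 2\<close> in place of \<open>f\<close>, so the estimate expresses convexity of
  \<open>M / 2 * x\<^sup>2 + f x\<close> and \<open>M / 2 * x\<^sup>2 - f x\<close>.\<close>

lemma weak_deriv_2_bound:
  assumes wd: "has_weak_deriv 2 f g" and M: "AE x in leb01. \<bar>g x\<bar> \<le> M"
    and f: "continuous_on {0..1} f" and cd: "0 < c" "c \<le> d" "d < 1" and l: "0 \<le> l" "l \<le> 1"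
  defines "m \<equiv> (1 - l) * c + l * d"
  shows "\<bar>(1 - l) * f c - f m + l * f d\<bar> \<le> M * ((1 - l) * (c\<^sup>2 / 2) - m\<^sup>2 / 2 + l * (d\<^sup>2 / 2))"
proof (rule tendsto_le)
  have m: "c \<le> m" "m \<le> d"
    using convex_bound_le[of c d d "1 - l" l] convex_bound_le[of "-c" "-c" "-d" "1 - l" l] cd l
    by (auto simp: m_def algebra_simps mult_left_mono)
  define A where "A = (\<lambda>f c \<epsilon>. \<integral>x. f x * kernel \<epsilon> c x \<partial>leb01)"
  define B where "B = (\<lambda>f \<epsilon>. (1 - l) * A f c \<epsilon> - A f m \<epsilon> + l * A f d \<epsilon>)"
  have B: "(B f \<longlongrightarrow> (1 - l) * f c - f m + l * f d) (at_right 0)" if "continuous_on {0..1} f" for f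
    unfolding A_def B_def by (intro tendsto_intros kernel_tendsto that) (use cd m in auto)
  have eq: "(\<integral>x. f x * tent'' \<epsilon> l c d x \<partial>leb01) = B f \<epsilon>"
    if f: "continuous_on {0..1} f" for f \<epsilon>
  proof -
    have int: "integrable leb01 (\<lambda>x. f x * kernel \<epsilon> c x)" for c
      by (auto intro!: integrable_leb01_continuous continuous_intros f)
    have "(\<lambda>x. f x * tent'' \<epsilon> l c d x)
        = (\<lambda>x. (1 - l) * (f x * kernel \<epsilon> c x) - f x * kernel \<epsilon> m x + l * (f x * kernel \<epsilon> d x))"
      by (auto simp: tent''_def m_def algebra_simps)
    then show ?thesis
      using int by (simp add: B_def A_def)
  qed
  show "((\<lambda>\<epsilon>. \<bar>B f \<epsilon>\<bar>) \<longlongrightarrow> \<bar>(1 - l) * f c - f m + l * f d\<bar>) (at_right 0)"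
    by (intro tendsto_intros B f)
  show "((\<lambda>\<epsilon>. M * B (\<lambda>x. x\<^sup>2 / 2) \<epsilon>) \<longlongrightarrow>
      M * ((1 - l) * (c\<^sup>2 / 2) - m\<^sup>2 / 2 + l * (d\<^sup>2 / 2))) (at_right 0)"
    by (intro tendsto_intros B continuous_intros) auto
  have "\<forall>\<^sub>F \<epsilon> in at_right 0. \<epsilon> \<in> {0<..<1 - d}"
    using cd by (intro eventually_at_right_real) auto
  then show "\<forall>\<^sub>F \<epsilon> in at_right 0. \<bar>B f \<epsilon>\<bar> \<le> M * B (\<lambda>x. x\<^sup>2 / 2) \<epsilon>"
  proof eventually_elim
    case (elim \<epsilon>)
    then have \<epsilon>: "\<epsilon> > 0" "d + \<epsilon> < 1" by auto
    have "deriv (tent \<epsilon> l c d) = tent' \<epsilon> l c d" "deriv (tent' \<epsilon> l c d) = tent'' \<epsilon> l c d"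
      using \<epsilon> by (auto intro!: ext DERIV_imp_deriv tent_deriv tent'_deriv)
    then have deriv2: "(deriv ^^ 2) (tent \<epsilon> l c d) = tent'' \<epsilon> l c d"
      by (simp add: numeral_2_eq_2)
    have "continuous_on {0..1} (\<lambda>x::real. x\<^sup>2 / 2)" by (auto intro!: continuous_intros)
    then have "(\<integral>x. tent \<epsilon> l c d x \<partial>leb01) = B (\<lambda>x. x\<^sup>2 / 2) \<epsilon>"
      using tent_integral cd \<epsilon> l by (simp only: eq)
    then show ?case
      using weak_deriv_integral_bound[OF wd M test_fun_tent tent_nonneg, of \<epsilon> c d l] cd \<epsilon> l
      by (simp only: deriv2 eq[OF f])
  qed
qed simp

text \<open>Plateaus converge pointwise to the indicator of \<open>{c<..d}\<close> and are bounded
  by 1, so dominated convergence carries the hypothesis from test functions to this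
  indicator.\<close>

lemma integral_Ioc_eq_0:
  assumes k: "locally_integrable k" and zero: "\<And>\<phi>. test_fun \<phi> \<Longrightarrow> (\<integral>x. k x * \<phi> x \<partial>leb01) = 0"
    and cd: "0 < c" "c \<le> d" "d < 1"
  shows "(\<integral>x. indicator {c<..d} x * k x \<partial>lebesgue) = 0"
proof -
  \<comment> \<open>\<open>b\<close> lies between \<open>d\<close> and 1, so all plateaus used are
    supported in the compact \<open>{c..b}\<close>, where \<open>k\<close> is integrable.\<close>
  define b where "b = (1 + d) / 2"
  have b: "d < b" "b < 1" using cd by (auto simp: b_def)
  define \<epsilon> where "\<epsilon> n = (b - d) / real (Suc n)" for n
  have \<epsilon>: "\<epsilon> n > 0" "d + \<epsilon> n \<le> b" for n
  proof -
    show "\<epsilon> n > 0" using b by (simp add: \<epsilon>_def)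
    have "(b - d) / real (Suc n) \<le> (b - d) / 1" using b by (intro divide_left_mono) auto
    then show "d + \<epsilon> n \<le> b" by (simp add: \<epsilon>_def)
  qed
  have \<epsilon>_lim: "\<epsilon> \<longlonglongrightarrow> 0"
    unfolding \<epsilon>_def[abs_def] by (rule LIMSEQ_Suc[OF lim_const_over_n])
  let ?K = "\<lambda>x. indicator {c..b} x * k x"
  have int: "integrable lebesgue ?K"
    using k cd b unfolding locally_integrable_def
    by (auto dest!: spec[of _ "{c..b}"] simp: integrable_restrict_space)
  have plat_meas: "plateau e c d \<in> borel_measurable lebesgue" if "e > 0" for e
  proof (rule measurable_completion)
    have "plateau e c d \<in> borel_measurable borel"
      using that by (intro borel_measurable_continuous_onI smooth_continuous smooth_plateau) simp
    then show "plateau e c d \<in> borel_measurable lborel" by simp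
  qed
  have "(\<lambda>n. \<integral>x. ?K x * plateau (\<epsilon> n) c d x \<partial>lebesgue) \<longlonglongrightarrow> (\<integral>x. ?K x * indicator {c<..d} x \<partial>lebesgue)"
  proof (rule integral_dominated_convergence)
    show "integrable lebesgue (\<lambda>x. \<bar>?K x\<bar>)" using int by simp
    show "(\<lambda>x. ?K x * indicator {c<..d} x) \<in> borel_measurable lebesgue"
      by (intro borel_measurable_times[OF borel_measurable_integrable[OF int]] borel_measurable_indicator) simp
    show "(\<lambda>x. ?K x * plateau (\<epsilon> n) c d x) \<in> borel_measurable lebesgue" for n
      by (rule borel_measurable_times[OF borel_measurable_integrable[OF int] plat_meas[OF \<epsilon>(1)]])
    have "\<bar>plateau (\<epsilon> n) c d x\<bar> \<le> 1" for n x
    proof -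
      have "0 \<le> step e a x" "step e a x \<le> 1" if "e > 0" for e a
        unfolding step_def
        using monoD[OF mono_H, of "min 0 ((x - a) / e)" "(x - a) / e"]
          monoD[OF mono_H, of "(x - a) / e" "max 1 ((x - a) / e)"] H_left[of "min 0 ((x - a) / e)"]
          H_right[of "max 1 ((x - a) / e)"] by auto
      from this[OF \<epsilon>(1), of n c] this[OF \<epsilon>(1), of n d] show ?thesis
        unfolding plateau_def by linarith
    qed
    then have "\<bar>?K x\<bar> * \<bar>plateau (\<epsilon> n) c d x\<bar> \<le> \<bar>?K x\<bar> * 1" for n x
      by (intro mult_left_mono) auto
    then show "AE x in lebesgue. norm (?K x * plateau (\<epsilon> n) c d x) \<le> \<bar>?K x\<bar>" for n
      by (auto simp: abs_mult)
    have "(\<lambda>n. plateau (\<epsilon> n) c d x) \<longlonglongrightarrow> indicator {c<..d} x" for x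
    proof (rule tendsto_eventually)
      \<comment> \<open>Once \<open>\<epsilon> n\<close> is below \<open>\<delta>\<close>, every
        transition that starts left of \<open>x\<close> is complete at \<open>x\<close>. Up to
        \<open>c\<close> the plateau is 0 anyway, so 1 is an arbitrary positive choice
        there.\<close>
      define \<delta> where "\<delta> = (if x \<le> c then 1 else if x \<le> d then x - c else x - d)"
      have "\<delta> > 0" by (auto simp: \<delta>_def)
      with order_tendstoD(2)[OF \<epsilon>_lim] have "\<forall>\<^sub>F n in sequentially. \<epsilon> n < \<delta>" by blast
      then show "\<forall>\<^sub>F n in sequentially. plateau (\<epsilon> n) c d x = indicator {c<..d} x"
      proof eventually_elim
        case (elim n)
        then show ?case
          using \<epsilon>(1)[of n] cd
          by (auto simp: plateau_def \<delta>_def step_left step_right split: if_splits)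
      qed
    qed
    then show "AE x in lebesgue. (\<lambda>n. ?K x * plateau (\<epsilon> n) c d x) \<longlonglongrightarrow> ?K x * indicator {c<..d} x"
      by (intro AE_I2 tendsto_intros)
  qed
  moreover have "(\<integral>x. ?K x * plateau (\<epsilon> n) c d x \<partial>lebesgue) = 0" for n
  proof -
    have "(\<integral>x. ?K x * plateau (\<epsilon> n) c d x \<partial>lebesgue)
        = (\<integral>x. indicator {0..1} x *\<^sub>R (k x * plateau (\<epsilon> n) c d x) \<partial>lebesgue)"
    proof (rule Bochner_Integration.integral_cong)
      fix x
      show "?K x * plateau (\<epsilon> n) c d x = indicator {0..1} x *\<^sub>R (k x * plateau (\<epsilon> n) c d x)"
        using plateau_eq_0[OF \<epsilon>(1) cd(2), of x n] \<epsilon>(2)[of n] cd b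
        by (cases "x \<in> {c..d + \<epsilon> n}") auto
    qed simp
    also have "\<dots> = (\<integral>x. k x * plateau (\<epsilon> n) c d x \<partial>leb01)"
      by (simp add: integral_restrict_space)
    also have "\<dots> = 0"
      by (rule zero[OF test_fun_plateau]) (use \<epsilon>[of n] cd b in auto)
    finally show ?thesis .
  qed
  ultimately have "(\<integral>x. ?K x * indicator {c<..d} x \<partial>lebesgue) = 0"
    by (simp add: LIMSEQ_const_iff)
  also have "(\<lambda>x. ?K x * indicator {c<..d} x) = (\<lambda>x. indicator {c<..d} x * k x)"
    using b by (auto simp: indicator_def)
  finally show ?thesis .
qed

end

section \<open>Uniqueness of weak derivatives\<close>

text \<open>A Dynkin system argument: half-open intervals are closed under intersection and generate
  the Borel sets, so the integral vanishes over every Borel set, which forces the density to be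
  zero.\<close>

lemma AE_zero_if_Ioc_integrals_zero:
  fixes k :: "real \<Rightarrow> real"
  assumes int: "integrable lebesgue k"
    and zero: "\<And>c d. c \<le> d \<Longrightarrow> (\<integral>x. indicator {c<..d} x * k x \<partial>lebesgue) = 0"
    and total: "(\<integral>x. k x \<partial>lebesgue) = 0"
  shows "AE x in lebesgue. k x = 0"
proof -
  \<comment> \<open>A Borel representative is taken because the argument by generators reaches Borel
    sets only.\<close>
  obtain k' where k': "k' \<in> borel_measurable lborel" "AE x in lborel. k x = k' x"
    using completion_ex_borel_measurable_real[of k lborel] int by auto
  have k'_eq: "AE x in lebesgue. k x = k' x"
    by (rule AE_completion[OF k'(2)])
  have k'_meas: "k' \<in> borel_measurable lebesgue"
    using k'(1) by (rule measurable_completion)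
  have int': "integrable lebesgue k'"
    using integrable_cong_AE[OF _ k'_meas k'_eq] int by auto
  then have int_lborel: "integrable lborel k'"
    using k'(1) by (simp add: integrable_completion)
  have set_int: "set_integrable lborel B k'" if "B \<in> sets borel" for B
    using int_lborel that unfolding set_integrable_def
    by (intro integrable_mult_indicator) auto
  have sets: "sets borel = sigma_sets UNIV (range (\<lambda>(a, b). {a<..b::real}))"
    by (subst borel_sigma_sets_Ioc) simp
  have "set_lebesgue_integral lborel A k' = 0" if "A \<in> sets lborel" for A
  proof -
    have "Int_stable (range (\<lambda>(a, b). {a<..b::real}))"
      unfolding Int_stable_def by (force simp: Int_greaterThanAtMost)
    moreover have "range (\<lambda>(a, b). {a<..b::real}) \<subseteq> Pow UNIV" by simp
    moreover have "A \<in> sigma_sets UNIV (range (\<lambda>(a, b). {a<..b::real}))"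
      using that sets by simp
    ultimately show ?thesis
    proof (induction rule: sigma_sets_induct_disjoint)
      case (basic A)
      then obtain a b where A: "A = {a<..b}" by auto
      have "set_lebesgue_integral lborel A k' = (\<integral>x. indicator A x *\<^sub>R k' x \<partial>lebesgue)"
        unfolding set_lebesgue_integral_def using k'(1) A
        by (intro integral_completion[symmetric]) auto
      also have "\<dots> = (\<integral>x. indicator A x *\<^sub>R k x \<partial>lebesgue)"
      proof (rule integral_cong_AE)
        have "(indicator A :: real \<Rightarrow> real) \<in> borel_measurable lebesgue"
          unfolding A by (intro borel_measurable_indicator) simp
        then show "(\<lambda>x. indicator A x *\<^sub>R k' x) \<in> borel_measurable lebesgue"
            "(\<lambda>x. indicator A x *\<^sub>R k x) \<in> borel_measurable lebesgue"
          using k'_meas borel_measurable_integrable[OF int]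
          by (auto intro!: borel_measurable_scaleR)
        show "AE x in lebesgue. indicator A x *\<^sub>R k' x = indicator A x *\<^sub>R k x"
          using k'_eq by eventually_elim simp
      qed
      also have "\<dots> = 0"
        using zero[of a b] by (cases "a \<le> b") (auto simp: A)
      finally show ?case .
    next
      case (compl A)
      then have A: "A \<in> sets borel" 
        using sets by simp
      \<comment> \<open>Passing to complements requires the integral over the whole line to
        vanish.\<close>
      have "(\<integral>x. k' x \<partial>lborel) = 0"
        using total integral_cong_AE[OF _ k'_meas k'_eq] int integral_completion[OF k'(1)] by auto
      then have "set_lebesgue_integral lborel (A \<union> (UNIV - A)) k' = 0"
        by (simp add: set_lebesgue_integral_def)
      then show ?case
        using compl.IH A by (subst (asm) set_integral_Un) (auto intro: set_int)
    next
      case (union A)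
      then have A: "A i \<in> sets borel" for i
        using sets by auto
      have "set_lebesgue_integral lborel (\<Union>i. A i) k' = (\<Sum>i. set_lebesgue_integral lborel (A i) k')"
        using A union(1) by (intro lebesgue_integral_countable_add set_int sets.countable_UN)
          (auto simp: disjoint_family_on_def)
      with union.IH show ?case by simp
    qed (auto simp: set_lebesgue_integral_def)
  qed
  then have "AE x in lborel. k' x = 0"
    by (rule sigma_finite_measure.density_zero[OF sigma_finite_lborel int_lborel])
  then have "AE x in lebesgue. k' x = 0" by (rule AE_completion)
  with k'_eq show ?thesis by eventually_elim simp
qed

text \<open>\<open>k\<close> is known to be integrable only away from the endpoints, so it is first
  cut off to some \<open>{a<..b}\<close> inside the open interval; countably many of these exhaust
  it, and the two endpoints are null.\<close>

lemma fundamental_lemma_calculus_of_variations: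
  assumes k: "locally_integrable k" and zero: "\<And>\<phi>. test_fun \<phi> \<Longrightarrow> (\<integral>x. k x * \<phi> x \<partial>leb01) = 0"
  shows "AE x in leb01. k x = 0"
proof -
  obtain r H \<Theta> \<kappa> where "smooth_ramp r H \<Theta> \<kappa>" using smooth_ramp_exists by blast
  then interpret smooth_ramp r H \<Theta> \<kappa> .
  have inner: "AE x in lebesgue. indicator {a<..b} x * k x = 0" if ab: "0 < a" "a \<le> b" "b < 1" for a b
  proof (rule AE_zero_if_Ioc_integrals_zero)
    have "integrable lebesgue (\<lambda>x. indicator {a..b} x *\<^sub>R k x)"
      using k ab unfolding locally_integrable_def
      by (auto dest!: spec[of _ "{a..b}"] simp: integrable_restrict_space)
    then have "integrable lebesgue (\<lambda>x. indicator {a<..b} x *\<^sub>R (indicator {a..b} x *\<^sub>R k x))"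
      by (rule integrable_mult_indicator[rotated]) simp
    also have "(\<lambda>x. indicator {a<..b} x *\<^sub>R (indicator {a..b} x *\<^sub>R k x)) = (\<lambda>x. indicator {a<..b} x * k x)"
      by (auto simp: indicator_def)
    finally show "integrable lebesgue (\<lambda>x. indicator {a<..b} x * k x)" .
  next
    fix c d :: real assume "c \<le> d"
    \<comment> \<open>Half-open intervals intersect in half-open intervals, so the cut-off leads
      back to integrals already known to vanish.\<close>
    have eq: "(\<lambda>x. indicator {c<..d} x * (indicator {a<..b} x * k x))
        = (\<lambda>x. indicator {max a c<..min b d} x * k x)"
      by (auto simp: indicator_def)
    show "(\<integral>x. indicator {c<..d} x * (indicator {a<..b} x * k x) \<partial>lebesgue) = 0"
    proof (cases "max a c \<le> min b d")
      case True
      then show ?thesis unfolding eq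
        using ab by (intro integral_Ioc_eq_0[OF k zero]) auto
    next
      case False
      then have empty: "{max a c<..min b d} = {}" by auto
      show ?thesis unfolding eq empty by simp
    qed
  qed (rule integral_Ioc_eq_0[OF k zero ab])
  \<comment> \<open>The shift by 3 keeps the left endpoint below the right one already for
    \<open>n = 0\<close>.\<close>
  have "AE x in lebesgue. \<forall>n::nat. indicator {1 / (n + 3)<..1 - 1 / (n + 3)} x * k x = 0"
    unfolding AE_all_countable by (intro allI inner) (simp_all add: field_simps)
  moreover have "AE x in lebesgue. x \<noteq> 0 \<and> x \<noteq> (1::real)"
    using AE_lborel_singleton[of "0::real"] AE_lborel_singleton[of "1::real"]
    by (intro AE_completion AE_conjI)
  ultimately have "AE x in lebesgue. x \<in> {0..1} \<longrightarrow> k x = 0"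
  proof eventually_elim
    case (elim x)
    show ?case
    proof
      assume "x \<in> {0..1}"
      with elim(2) have x: "min x (1 - x) > 0" by auto
      obtain n where n: "inverse (real (Suc n)) < min x (1 - x)"
        using reals_Archimedean[OF x] by blast
      have "1 / (real n + 3) < inverse (real (Suc n))" by (simp add: field_simps)
      with n have "x \<in> {1 / (real n + 3)<..1 - 1 / (real n + 3)}" by auto
      with elim(1)[rule_format, of n] show "k x = 0" by simp
    qed
  qed
  then show ?thesis by (simp add: AE_restrict_space_iff)
qed

text \<open>Local integrability yields measurability on compact parts of the open interval.
  Countably many of these cover it, and on the remaining singletons \<open>{0}\<close> and
  \<open>{1}\<close> every function is measurable.\<close>

lemma locally_integrable_measurable:
  assumes "locally_integrable g" shows "g \<in> borel_measurable leb01"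
proof -
  let ?C = "range (\<lambda>n::nat. {1 / (real n + 3)..1 - 1 / (real n + 3)}) \<union> {{0}, {1}}"
  show ?thesis
  proof (rule measurable_piecewise_restrict[of ?C])
    show "space leb01 \<subseteq> \<Union> ?C"
    proof
      fix x :: real assume "x \<in> space leb01"
      then have x: "x \<in> {0..1}" by simp
      show "x \<in> \<Union> ?C"
      proof (cases "x = 0 \<or> x = 1")
        case False
        with x have "min x (1 - x) > 0" by auto
        then obtain n where n: "inverse (real (Suc n)) < min x (1 - x)"
          using reals_Archimedean by blast
        have "1 / (real n + 3) < inverse (real (Suc n))" by (simp add: field_simps)
        with n have "x \<in> {1 / (real n + 3)..1 - 1 / (real n + 3)}" by auto
        then show ?thesis by blast
      qed auto
    qed
    fix \<Omega> assume "\<Omega> \<in> ?C"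
    then show "\<Omega> \<inter> space leb01 \<in> sets leb01"
      by (auto simp: sets_restrict_space_iff)
    from \<open>\<Omega> \<in> ?C\<close> consider n where "\<Omega> = {1 / (real n + 3)..1 - 1 / (real n + 3)}" | a where "a \<in> {0..1}" "\<Omega> = {a}"
      by auto
    then show "g \<in> borel_measurable (restrict_space leb01 \<Omega>)"
    proof cases
      case 1
      have sub: "\<Omega> \<subseteq> {0<..<1}" 
      proof
        fix x assume "x \<in> \<Omega>"
        moreover have "1 / (real n + 3) > 0" by simp
        ultimately show "x \<in> {0<..<1}"
          unfolding 1 greaterThanLessThan_iff atLeastAtMost_iff by linarith
      qed
      then have "{0..1} \<inter> \<Omega> = \<Omega>" by auto
      then have "restrict_space leb01 \<Omega> = lebesgue_on \<Omega>"
        unfolding 1 by (subst restrict_restrict_space) auto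
      moreover have "integrable (lebesgue_on \<Omega>) g"
        using assms sub unfolding locally_integrable_def 1 by blast
      ultimately show ?thesis by simp
    next
      case 2
      have "(\<lambda>_. g a) \<in> borel_measurable (restrict_space leb01 \<Omega>)" by simp
      then show ?thesis
        by (subst measurable_cong[of _ _ "\<lambda>_. g a"]) (auto simp: 2 space_restrict_space)
    qed
  qed simp
qed

lemma continuous_on_unit_interval_bounded:
  fixes f :: "real \<Rightarrow> real"
  assumes "continuous_on {0..1} f" shows "\<exists>B. \<forall>x\<in>{0..1}. \<bar>f x\<bar> \<le> B"
proof -
  have "bounded (f ` {0..1})"
    using assms by (intro compact_imp_bounded compact_continuous_image) auto
  then show ?thesis by (auto simp: bounded_iff)
qed

text \<open>\<open>g\<close> is integrable on the compact support of \<open>\<phi>\<close>, and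
  \<open>\<phi>\<close> is bounded. This integrability allows the integral of a difference to be
  split in the uniqueness proof.\<close>

lemma locally_integrable_times_test_fun:
  assumes "locally_integrable g" "test_fun \<phi>" shows "integrable leb01 (\<lambda>x. g x * \<phi> x)"
proof -
  define K where "K = closure {x. \<phi> x \<noteq> 0}"
  have K: "K \<subseteq> {0<..<1}" using assms(2) by (simp add: K_def test_fun_def)
  have "compact K"
    using bounded_subset[OF _ K] by (simp add: compact_eq_bounded_closed K_def)
  with assms(1) K have int: "integrable (lebesgue_on K) g" by (simp add: locally_integrable_def)
  have K_sets: "K \<in> sets lebesgue" unfolding K_def by simp
  have cont: "continuous_on S \<phi>" for S by (intro smooth_continuous test_fun_smooth assms(2))
  obtain B where B: "\<And>x. x \<in> {0..1} \<Longrightarrow> \<bar>\<phi> x\<bar> \<le> B"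
    using continuous_on_unit_interval_bounded[OF cont] by blast
  have "integrable lebesgue (\<lambda>x. indicator K x *\<^sub>R g x)"
    using int K_sets by (simp add: integrable_restrict_space)
  then have "integrable lebesgue (\<lambda>x. indicator {0..1} x *\<^sub>R (indicator K x *\<^sub>R g x))"
    by (rule integrable_mult_indicator[rotated]) simp
  then have intK: "integrable leb01 (\<lambda>x. indicator K x *\<^sub>R g x)"
    by (subst integrable_restrict_space) simp_all
  show ?thesis
  proof (rule Bochner_Integration.integrable_bound)
    show "integrable leb01 (\<lambda>x. B *\<^sub>R (indicator K x *\<^sub>R g x))"
      using intK by (intro integrable_scaleR_right)
    show "(\<lambda>x. g x * \<phi> x) \<in> borel_measurable leb01"
      by (intro borel_measurable_times locally_integrable_measurable assms
          borel_measurable_integrable integrable_leb01_continuous cont)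
    show "AE x in leb01. norm (g x * \<phi> x) \<le> norm (B *\<^sub>R (indicator K x *\<^sub>R g x))"
    proof (rule AE_I2)
      fix x assume "x \<in> space leb01"
      then have x: "x \<in> {0..1}" by simp
      have "\<phi> x = 0" if "x \<notin> K"
        using that closure_subset[of "{x. \<phi> x \<noteq> 0}"] by (auto simp: K_def)
      moreover have "\<bar>g x\<bar> * \<bar>\<phi> x\<bar> \<le> \<bar>g x\<bar> * \<bar>B\<bar>"
        using B[OF x] by (intro mult_left_mono) auto
      ultimately show "norm (g x * \<phi> x) \<le> norm (B *\<^sub>R (indicator K x *\<^sub>R g x))"
        by (cases "x \<in> K") (auto simp: abs_mult mult.commute)
    qed
  qed
qed

lemma has_weak_deriv_unique:
  assumes g: "has_weak_deriv j f g" and h: "has_weak_deriv j f h"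
  shows "AE x in leb01. g x = h x"
proof -
  have loc: "locally_integrable g" "locally_integrable h"
    using g h by (auto simp: has_weak_deriv_def)
  have "AE x in leb01. g x - h x = 0"
  proof (rule fundamental_lemma_calculus_of_variations)
    show "locally_integrable (\<lambda>x. g x - h x)"
      using loc unfolding locally_integrable_def by auto
    fix \<phi> assume \<phi>: "test_fun \<phi>"
    have "(\<integral>x. f x * (deriv ^^ j) \<phi> x \<partial>leb01) = (- 1) ^ j * (\<integral>x. g x * \<phi> x \<partial>leb01)"
        "(\<integral>x. f x * (deriv ^^ j) \<phi> x \<partial>leb01) = (- 1) ^ j * (\<integral>x. h x * \<phi> x \<partial>leb01)"
      using g h \<phi> by (simp_all add: has_weak_deriv_def)
    then have "(\<integral>x. g x * \<phi> x \<partial>leb01) = (\<integral>x. h x * \<phi> x \<partial>leb01)" by simp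
    then show "(\<integral>x. (g x - h x) * \<phi> x \<partial>leb01) = 0"
      using loc[THEN locally_integrable_times_test_fun, OF \<phi>] by (simp add: left_diff_distrib)
  qed
  then show ?thesis by eventually_elim simp
qed

section \<open>Essential bounds for the chosen weak derivatives\<close>

lemma AE_abs_le_Lp_norm_infinity:
  assumes "g \<in> borel_measurable leb01" "AE x in leb01. \<bar>g x\<bar> \<le> B"
  shows "AE x in leb01. \<bar>g x\<bar> \<le> Lp_norm \<infinity> g"
proof -
  let ?e = "esssup leb01 (\<lambda>x. ereal \<bar>g x\<bar>)"
  \<comment> \<open>The bound \<open>B\<close> excludes an infinite essential supremum, which
    conversion to a real number would turn into 0.\<close>
  have "?e \<le> ereal B"
    using assms by (intro esssup_I) auto
  then have "?e \<noteq> \<infinity>" by auto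
  with esssup_AE[of "\<lambda>x. ereal \<bar>g x\<bar>" leb01] show ?thesis
    unfolding Lp_norm_def by (cases ?e) (auto elim!: eventually_mono)
qed

lemma Lp_norm_nonneg: "Lp_norm p g \<ge> 0"
proof (cases "p = \<infinity>")
  case True
  have "esssup leb01 (\<lambda>x. ereal \<bar>g x\<bar>) \<ge> 0"
  proof (rule ccontr)
    assume "\<not> ?thesis"
    \<comment> \<open>A negative value would force \<open>\<bar>g x\<bar> < 0\<close> almost
      everywhere, impossible on a space of positive measure.\<close>
    with esssup_AE[of "\<lambda>x. ereal \<bar>g x\<bar>" leb01] have "AE x in leb01. False"
      by (auto elim!: eventually_mono simp: not_le dest: le_less_trans)
    then have "emeasure leb01 (space leb01) = 0"
      by (simp add: eventually_False ae_filter_eq_bot_iff)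
    then show False by (simp add: emeasure_restrict_space)
  qed
  with True show ?thesis by (simp add: Lp_norm_def real_of_ereal_pos)
qed (simp add: Lp_norm_def)

text \<open>Membership provides some essentially bounded weak derivative; uniqueness passes its
  bound on to the representative selected by \<open>weak_deriv\<close>, whose norm is one of the
  values under the maximum.\<close>

lemma sobolev_infinity_weak_deriv:
  assumes "f \<in> sobolev r \<infinity>" "j \<le> r"
  shows "has_weak_deriv j f (weak_deriv j f)"
    "AE x in leb01. \<bar>weak_deriv j f x\<bar> \<le> sobolev_norm r \<infinity> f"
proof -
  obtain g where g: "g \<in> Lp_space \<infinity>" "has_weak_deriv j f g"
    using assms by (auto simp: sobolev_def)
  show wd: "has_weak_deriv j f (weak_deriv j f)"
    unfolding weak_deriv_def by (rule someI[of _ g]) (rule g)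
  obtain B where "AE x in leb01. \<bar>g x\<bar> \<le> B"
    using g by (auto simp: Lp_space_def)
  with has_weak_deriv_unique[OF wd g(2)] have "AE x in leb01. \<bar>weak_deriv j f x\<bar> \<le> B"
    by eventually_elim simp
  moreover have "weak_deriv j f \<in> borel_measurable leb01"
    using wd by (intro locally_integrable_measurable) (simp add: has_weak_deriv_def)
  ultimately have "AE x in leb01. \<bar>weak_deriv j f x\<bar> \<le> Lp_norm \<infinity> (weak_deriv j f)"
    by (intro AE_abs_le_Lp_norm_infinity)
  moreover have "Lp_norm \<infinity> (weak_deriv j f) \<le> sobolev_norm r \<infinity> f"
    unfolding sobolev_norm_def using assms(2) by (intro Max_ge) auto
  ultimately show "AE x in leb01. \<bar>weak_deriv j f x\<bar> \<le> sobolev_norm r \<infinity> f"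
    by (auto elim!: eventually_mono)
qed

section \<open>The pointwise estimate\<close>

text \<open>
  The two signs give a parabola above \<open>f\<close> and one below, both touching at \<open>x\<close>. Their slopes there
  need not be identified with \<open>f' x\<close>, so differentiability of \<open>f\<close> is never established.
\<close>

lemma sobolev_touching_parabola:
  assumes f: "f \<in> sobolev 2 \<infinity>" "f \<in> C01" and x: "0 < x" "x < 1" and s: "\<bar>s\<bar> = 1"
  defines "M \<equiv> sobolev_norm 2 \<infinity> f"
  obtains a b where "\<bar>a\<bar> \<le> 2 * M" "\<bar>b\<bar> \<le> 4 * M" "s * f x = b + a * x + M / 2 * x\<^sup>2"
    "\<And>t. t \<in> {0..1} \<Longrightarrow> s * f t \<le> b + a * t + M / 2 * t\<^sup>2"
proof -
  obtain r H \<Theta> \<kappa> where "smooth_ramp r H \<Theta> \<kappa>" using smooth_ramp_exists by blast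
  then interpret smooth_ramp r H \<Theta> \<kappa> .
  have cont: "continuous_on {0..1} f" using f by (simp add: C01_def)
  note wd = sobolev_infinity_weak_deriv[OF f(1), folded M_def]
  have f0: "\<bar>f x\<bar> \<le> M"
    by (rule weak_deriv_0_bound[OF wd cont x]) auto
  then have "M \<ge> 0" by linarith
  have lip: "\<bar>f c - f d\<bar> \<le> M * (d - c)" if "0 < c" "c \<le> d" "d < 1" for c d
    by (rule weak_deriv_1_bound[OF wd cont that]) auto
  have second: "\<bar>(1 - l) * f c - f ((1 - l) * c + l * d) + l * f d\<bar>
      \<le> M * ((1 - l) * (c\<^sup>2 / 2) - ((1 - l) * c + l * d)\<^sup>2 / 2 + l * (d\<^sup>2 / 2))"
    if "0 < c" "c \<le> d" "d < 1" "0 \<le> l" "l \<le> 1" for c d l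
    by (rule weak_deriv_2_bound[OF wd cont that]) auto
  have s_cases: "s = 1 \<or> s = -1" using s by linarith
  define u where "u = (\<lambda>t. M / 2 * t\<^sup>2 - s * f t)"
  have "convex_on {0<..<1} u"
  proof (rule convex_on_linorderI)
    fix l c d :: real
    assume "0 < l" "l < 1" "c \<in> {0<..<1}" "d \<in> {0<..<1}" "c < d"
    with second[of c d l] have
      "s * ((1 - l) * f c - f ((1 - l) * c + l * d) + l * f d)
      \<le> M * ((1 - l) * (c\<^sup>2 / 2) - ((1 - l) * c + l * d)\<^sup>2 / 2 + l * (d\<^sup>2 / 2))"
      using s_cases by auto
    then show "u ((1 - l) *\<^sub>R c + l *\<^sub>R d) \<le> (1 - l) * u c + l * u d"
      by (simp add: u_def algebra_simps)
  qed simp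
  \<comment> \<open>\<open>p\<close> is the right derivative of the convex \<open>u\<close> at
    \<open>x\<close>, hence the slope of a supporting line.\<close>
  define p where "p = Inf ((\<lambda>t. (u x - u t) / (x - t)) ` ({x<..} \<inter> {0<..<1}))"
  have sub: "u y \<ge> u x + p * (y - x)" if "y \<in> {0<..<1}" for y
    unfolding p_def using that x
    by (intro convex_le_Inf_differential[OF \<open>convex_on {0<..<1} u\<close>]) auto
  \<comment> \<open>On the unit interval \<open>M / 2 * t\<^sup>2\<close> and \<open>s * f t\<close>
    contribute a Lipschitz constant \<open>M\<close> each.\<close>
  have u_lip: "u d - u c \<le> 2 * M * (d - c)" "u c - u d \<le> 2 * M * (d - c)"
    if cd: "0 < c" "c \<le> d" "d < 1" for c d
  proof -
    have "M / 2 * (d\<^sup>2 - c\<^sup>2) = M * (d - c) * ((d + c) / 2)"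
      by (simp add: power2_eq_square field_simps)
    also have "\<dots> \<le> M * (d - c) * 1"
      using cd \<open>M \<ge> 0\<close> by (intro mult_left_mono) auto
    finally have "M / 2 * d\<^sup>2 - M / 2 * c\<^sup>2 \<le> M * (d - c)" by (simp add: algebra_simps)
    moreover have "M / 2 * c\<^sup>2 \<le> M / 2 * d\<^sup>2"
      using cd \<open>M \<ge> 0\<close> by (intro mult_left_mono power_mono) auto
    moreover have "\<bar>s * f c - s * f d\<bar> \<le> M * (d - c)"
      using lip[OF cd] s_cases by auto
    ultimately show "u d - u c \<le> 2 * M * (d - c)" "u c - u d \<le> 2 * M * (d - c)"
      unfolding u_def by linarith+
  qed
  \<comment> \<open>The supporting line lies below \<open>u\<close>; comparing it with the Lipschitz
    bound at one point right of \<open>x\<close>, and then at one point left of \<open>x\<close>,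
    bounds the slope on both sides.\<close>
  have "p \<le> 2 * M"
  proof -
    obtain y where y: "x < y" "y < 1" using dense[OF x(2)] by blast
    then have "u x + p * (y - x) \<le> u y" "u y - u x \<le> 2 * M * (y - x)"
      using sub[of y] u_lip(1)[of x y] x by auto
    then have "p * (y - x) \<le> 2 * M * (y - x)" by linarith
    with y show ?thesis by simp
  qed
  moreover have "- p \<le> 2 * M"
  proof -
    obtain y where y: "0 < y" "y < x" using dense[OF x(1)] by blast
    then have "u x + p * (y - x) \<le> u y" "u y - u x \<le> 2 * M * (x - y)"
      using sub[of y] u_lip(2)[of y x] x by auto
    then have "p * (y - x) \<le> 2 * M * (x - y)" by linarith
    then have "(- p) * (x - y) \<le> 2 * M * (x - y)" by (simp add: algebra_simps)
    with y show ?thesis by (subst (asm) mult_le_cancel_right) simp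
  qed
  ultimately have p: "\<bar>p\<bar> \<le> 2 * M" by linarith
  \<comment> \<open>The negated constant term of the line supporting \<open>u\<close> at
    \<open>x\<close>. Its three summands are at most \<open>M\<close>, \<open>M / 2\<close> and
    \<open>2 * M\<close> in absolute value.\<close>
  define b where "b = s * f x - M / 2 * x\<^sup>2 + p * x"
  have "\<bar>p * x\<bar> \<le> 2 * M * 1"
    unfolding abs_mult using p x \<open>M \<ge> 0\<close> by (intro mult_mono) auto
  moreover have "0 \<le> M / 2 * x\<^sup>2" "M / 2 * x\<^sup>2 \<le> M / 2 * 1"
    using x \<open>M \<ge> 0\<close> by (auto intro!: mult_left_le simp: power_le_one)
  moreover have "\<bar>s * f x\<bar> \<le> M" using f0 s by (simp add: abs_mult)
  ultimately have b: "\<bar>b\<bar> \<le> 4 * M" using \<open>M \<ge> 0\<close> unfolding b_def by linarith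
  \<comment> \<open>The supporting line settles interior points; continuity extends the inequality
    to the endpoints.\<close>
  have "b + - p * t + M / 2 * t\<^sup>2 - s * f t \<ge> 0" if t: "t \<in> {0..1}" for t
  proof (rule continuous_ge_on_Ioo[of 0 1 "\<lambda>t. b + - p * t + M / 2 * t\<^sup>2 - s * f t"])
    show "continuous_on {0..1} (\<lambda>t. b + - p * t + M / 2 * t\<^sup>2 - s * f t)"
      by (intro continuous_intros cont)
    show "b + - p * y + M / 2 * y\<^sup>2 - s * f y \<ge> 0" if "y \<in> {0<..<1}" for y
      using sub[OF that] by (simp add: u_def b_def algebra_simps)
  qed (use t in auto)
  then show ?thesis
    using p b by (intro that[of "- p" b]) (auto simp: b_def)
qed

section \<open>From touching parabolas to the operator\<close>

lemma C01_intros: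
  "(\<lambda>t. \<alpha>) \<in> C01"
  "e_fun k \<in> C01"
  "g \<in> C01 \<Longrightarrow> (\<lambda>t. \<alpha> * g t) \<in> C01"
  "g \<in> C01 \<Longrightarrow> (\<lambda>t. - g t) \<in> C01"
  "g \<in> C01 \<Longrightarrow> h \<in> C01 \<Longrightarrow> (\<lambda>t. g t + h t) \<in> C01"
  "g \<in> C01 \<Longrightarrow> h \<in> C01 \<Longrightarrow> (\<lambda>t. g t - h t) \<in> C01"
  by (auto simp: C01_def e_fun_def intro!: continuous_intros)

text \<open>Monotonicity transports the parabola inequalities to \<open>T\<close>, translatability
  extracts the constant term and sublinearity separates the rest. Each term then misses its value at
  \<open>x\<close> by at most its coefficient times \<open>E\<close>, and contact at
  \<open>x\<close> turns these values into \<open>f x\<close>.\<close>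

lemma operator_pointwise_bound:
  assumes T: "sublinear_on {0..1} C01 T" "monotone_operator_on {0..1} C01 T"
      "strongly_translatable_on {0..1} C01 T"
    and f: "f \<in> sobolev 2 \<infinity>" "f \<in> C01" and x: "0 < x" "x < 1"
    and E: "\<bar>T (e_fun 0) x - e_fun 0 x\<bar> \<le> E" "\<bar>T (e_fun 1) x - e_fun 1 x\<bar> \<le> E"
      "\<bar>T (\<lambda>t. - e_fun 1 t) x + e_fun 1 x\<bar> \<le> E" "\<bar>T (e_fun 2) x - e_fun 2 x\<bar> \<le> E"
  defines "M \<equiv> sobolev_norm 2 \<infinity> f"
  shows "\<bar>f x - T f x\<bar> \<le> 7 * M * E"
proof -
  have xI: "x \<in> {0..1}" using x by simp
  have "E \<ge> 0" using E(1) by linarith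
  have add: "T (\<lambda>t. g t + h t) x \<le> T g x + T h x" if "g \<in> C01" "h \<in> C01" for g h
    using T(1) that xI unfolding sublinear_on_def by blast
  have scale: "T (\<lambda>t. \<alpha> * g t) x = \<alpha> * T g x" if "g \<in> C01" "\<alpha> \<ge> 0" for g \<alpha>
    using T(1) that xI unfolding sublinear_on_def by blast
  have mono: "T g x \<le> T h x" if "g \<in> C01" "h \<in> C01" "\<And>t. t \<in> {0..1} \<Longrightarrow> g t \<le> h t" for g h
    using T(2) that xI unfolding monotone_operator_on_def by blast
  have "(\<lambda>t. 1) = e_fun 0" by (auto simp: e_fun_def)
  then have trans: "T (\<lambda>t. g t + \<alpha>) x = T g x + \<alpha> * T (e_fun 0) x" if "g \<in> C01" for g \<alpha>
    using T(3) that xI unfolding strongly_translatable_on_def by metis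
  \<comment> \<open>Homogeneity covers nonnegative factors only; for negative
    \<open>\<alpha>\<close> the function is \<open>- \<alpha>\<close> times
    \<open>- e_fun 1\<close>, whence the third test error.\<close>
  have lin: "\<bar>T (\<lambda>t. \<alpha> * e_fun 1 t) x - \<alpha> * x\<bar> \<le> \<bar>\<alpha>\<bar> * E" for \<alpha>
  proof (cases "\<alpha> \<ge> 0")
    case True
    then have "T (\<lambda>t. \<alpha> * e_fun 1 t) x - \<alpha> * x = \<alpha> * (T (e_fun 1) x - e_fun 1 x)"
      using scale[OF C01_intros(2), of \<alpha> 1] by (simp add: e_fun_def algebra_simps)
    then show ?thesis
      using E(2) by (simp add: abs_mult mult_left_mono)
  next
    case False
    then have "T (\<lambda>t. \<alpha> * e_fun 1 t) x - \<alpha> * x = (- \<alpha>) * (T (\<lambda>t. - e_fun 1 t) x + e_fun 1 x)"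
      using scale[OF C01_intros(4)[OF C01_intros(2)], of "- \<alpha>" 1] by (simp add: e_fun_def algebra_simps)
    then show ?thesis
      using E(3) by (simp only: abs_mult abs_minus_cancel) (rule mult_left_mono, auto)
  qed
  have const: "\<bar>\<beta> * T (e_fun 0) x - \<beta>\<bar> \<le> \<bar>\<beta>\<bar> * E" for \<beta>
  proof -
    have "\<beta> * T (e_fun 0) x - \<beta> = \<beta> * (T (e_fun 0) x - e_fun 0 x)"
      by (simp add: e_fun_def algebra_simps)
    then show ?thesis using E(1) by (simp add: abs_mult mult_left_mono)
  qed
  have M: "M \<ge> 0"
    using sobolev_touching_parabola[OF f x, of 1] unfolding M_def
    by (metis abs_ge_zero abs_one order_trans zero_le_mult_iff zero_less_numeral not_le)
  have quad: "\<bar>M / 2 * T (e_fun 2) x - M / 2 * x\<^sup>2\<bar> \<le> M / 2 * E"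
  proof -
    have "M / 2 * T (e_fun 2) x - M / 2 * x\<^sup>2 = M / 2 * (T (e_fun 2) x - e_fun 2 x)"
      by (simp add: e_fun_def algebra_simps)
    also have "\<bar>\<dots>\<bar> = M / 2 * \<bar>T (e_fun 2) x - e_fun 2 x\<bar>" using M by (simp add: abs_mult)
    also have "\<dots> \<le> M / 2 * E" using E(4) M by (intro mult_left_mono) auto
    finally show ?thesis .
  qed
  have scale2: "T (\<lambda>t. M / 2 * e_fun 2 t) x = M / 2 * T (e_fun 2) x"
    using M by (intro scale C01_intros) simp
  \<comment> \<open>The coefficients add up to 2 + 4 + 1/2, rounded up to 7.\<close>
  have coeff: "\<bar>a\<bar> * E + \<bar>b\<bar> * E + M / 2 * E \<le> 7 * M * E"
    if "\<bar>a\<bar> \<le> 2 * M" "\<bar>b\<bar> \<le> 4 * M" for a b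
  proof -
    have "\<bar>a\<bar> * E \<le> 2 * M * E" "\<bar>b\<bar> * E \<le> 4 * M * E" "0 \<le> M * E"
      using that M \<open>E \<ge> 0\<close> by (auto intro!: mult_right_mono)
    then show ?thesis by linarith
  qed
  have "T f x - f x \<le> 7 * M * E"
  proof -
    obtain a b where ab: "\<bar>a\<bar> \<le> 2 * M" "\<bar>b\<bar> \<le> 4 * M" "1 * f x = b + a * x + M / 2 * x\<^sup>2"
      "\<And>t. t \<in> {0..1} \<Longrightarrow> 1 * f t \<le> b + a * t + M / 2 * t\<^sup>2"
      using sobolev_touching_parabola[OF f x, of 1] unfolding M_def by auto
    let ?q = "\<lambda>t. a * e_fun 1 t + M / 2 * e_fun 2 t"
    have q: "?q \<in> C01" by (intro C01_intros)
    have "T f x \<le> T (\<lambda>t. ?q t + b) x"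
      using f(2) ab(4) by (intro mono C01_intros) (auto simp: e_fun_def algebra_simps)
    also have "\<dots> = T ?q x + b * T (e_fun 0) x" by (rule trans[OF q])
    also have "T ?q x \<le> T (\<lambda>t. a * e_fun 1 t) x + M / 2 * T (e_fun 2) x"
      unfolding scale2[symmetric] by (intro add C01_intros)
    finally show ?thesis
      using lin[of a] const[of b] quad coeff[OF ab(1,2)] ab(3) by linarith
  qed
  moreover have "f x - T f x \<le> 7 * M * E"
  proof -
    obtain a b where ab: "\<bar>a\<bar> \<le> 2 * M" "\<bar>b\<bar> \<le> 4 * M" "-1 * f x = b + a * x + M / 2 * x\<^sup>2"
      "\<And>t. t \<in> {0..1} \<Longrightarrow> -1 * f t \<le> b + a * t + M / 2 * t\<^sup>2"
      using sobolev_touching_parabola[OF f x, of "-1"] unfolding M_def by auto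
    \<comment> \<open>Subadditivity bounds \<open>T\<close> of a sum only from above. The inequality
      for \<open>- f\<close> is therefore rearranged: the square joins \<open>f\<close> on the
      larger side and the negated affine part stays below.\<close>
    let ?l = "\<lambda>t. - a * e_fun 1 t"
    have l: "?l \<in> C01" and q: "(\<lambda>t. M / 2 * e_fun 2 t) \<in> C01" by (intro C01_intros)+
    have "T ?l x + (- b) * T (e_fun 0) x = T (\<lambda>t. ?l t + (- b)) x"
      by (rule trans[OF l, symmetric])
    also have "\<dots> \<le> T (\<lambda>t. f t + M / 2 * e_fun 2 t) x"
      using ab(4) by (intro mono C01_intros f(2)) (fastforce simp: e_fun_def)+
    also have "\<dots> \<le> T f x + M / 2 * T (e_fun 2) x"
      unfolding scale2[symmetric] by (intro add C01_intros f(2))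
    finally show ?thesis
      using lin[of "- a"] const[of "- b"] quad coeff[OF ab(1,2)] ab(3)
      unfolding abs_minus_cancel by linarith
  qed
  ultimately show ?thesis by linarith
qed

section \<open>The norm estimate\<close>

text \<open>The dominating \<open>u\<close> may change with \<open>x\<close>. For a finite exponent
  \<open>q\<close>, the sum over all of \<open>U\<close> of the powers of order \<open>q\<close>
  dominates whichever one is selected; for the infinite exponent \<open>c * L\<close> is already a
  bound.\<close>

lemma Lp_norm_le_finite_family:
  assumes p: "1 \<le> p" and U: "finite U" "U \<subseteq> C01" and v: "v \<in> C01" and "c \<ge> 0"
    and bound: "\<And>x. 0 < x \<Longrightarrow> x < 1 \<Longrightarrow> \<exists>u\<in>U. \<bar>v x\<bar> \<le> c * \<bar>u x\<bar>"
    and L: "\<And>u. u \<in> U \<Longrightarrow> Lp_norm p u \<le> L"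
  shows "Lp_norm p v \<le> real (card U) * c * L"
proof -
  have "U \<noteq> {}" using bound[of "1/2"] by auto
  then have card: "1 \<le> real (card U)"
    using U(1) by (simp add: Suc_le_eq card_gt_0_iff)
  have "L \<ge> 0" using \<open>U \<noteq> {}\<close> L Lp_norm_nonneg by (meson ex_in_conv order_trans)
  \<comment> \<open>The pointwise bound is given on the open interval only; the endpoints form a
    null set.\<close>
  have ends: "AE x in leb01. 0 < x \<and> x < 1"
  proof -
    have "AE x in lebesgue. x \<noteq> 0 \<and> x \<noteq> (1::real)"
      using AE_lborel_singleton[of "0::real"] AE_lborel_singleton[of "1::real"]
      by (intro AE_completion AE_conjI)
    then have "AE x in lebesgue. (x::real) \<in> {0..1} \<longrightarrow> 0 < x \<and> x < 1"
      by (rule eventually_mono) auto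
    moreover have "{0..1} \<inter> space lebesgue \<in> sets (lebesgue :: real measure)" by simp
    ultimately show ?thesis by (subst AE_restrict_space_iff)
  qed
  have meas: "g \<in> borel_measurable leb01" if "g \<in> C01" for g
    using that by (intro borel_measurable_integrable integrable_leb01_continuous) (simp add: C01_def)
  show ?thesis
  proof (cases "p = \<infinity>")
    case True
    have "AE x in leb01. \<bar>u x\<bar> \<le> L" if u: "u \<in> U" for u
    proof -
      have "u \<in> C01" using u U by auto
      then have "\<exists>B. \<forall>x\<in>{0..1}. \<bar>u x\<bar> \<le> B"
        by (intro continuous_on_unit_interval_bounded) (simp add: C01_def)
      then obtain B where B: "\<forall>x\<in>{0..1}. \<bar>u x\<bar> \<le> B" ..
      then have "AE x in leb01. \<bar>u x\<bar> \<le> Lp_norm \<infinity> u"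
        by (intro AE_abs_le_Lp_norm_infinity[of _ B] meas \<open>u \<in> C01\<close> AE_I2) simp
      with L[OF u] True show ?thesis by (auto elim!: eventually_mono)
    qed
    then have "AE x in leb01. \<forall>u\<in>U. \<bar>u x\<bar> \<le> L"
      using U(1) by (intro AE_finite_allI) auto
    with ends have "AE x in leb01. ereal \<bar>v x\<bar> \<le> ereal (c * L)"
    proof eventually_elim
      case (elim x)
      then obtain u where "u \<in> U" "\<bar>v x\<bar> \<le> c * \<bar>u x\<bar>" using bound by blast
      moreover have "c * \<bar>u x\<bar> \<le> c * L"
        using elim(2) \<open>u \<in> U\<close> \<open>c \<ge> 0\<close> by (intro mult_left_mono) auto
      ultimately show ?case by simp
    qed
    then have "esssup leb01 (\<lambda>x. ereal \<bar>v x\<bar>) \<le> ereal (c * L)"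
      using meas[OF v] by (intro esssup_I) auto
    then have "Lp_norm p v \<le> c * L"
      using True \<open>c \<ge> 0\<close> \<open>L \<ge> 0\<close>
      by (cases "esssup leb01 (\<lambda>x. ereal \<bar>v x\<bar>)") (auto simp: Lp_norm_def)
    also have "\<dots> \<le> real (card U) * (c * L)"
      using mult_right_mono[OF card, of "c * L"] \<open>c \<ge> 0\<close> \<open>L \<ge> 0\<close> by simp
    finally show ?thesis by (simp add: mult.assoc)
  next
    case False
    define q where "q = enn2real p"
    have q: "q \<ge> 1"
      using p False unfolding q_def by (cases p) (auto simp: enn2real_ennreal one_ennreal_def[symmetric] top_ennreal_def)
    have int: "integrable leb01 (\<lambda>x. \<bar>g x\<bar> powr q)" if "g \<in> C01" for g
      using that q
      by (intro integrable_leb01_continuous continuous_on_powr' continuous_intros) (auto simp: C01_def)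
    have norm: "Lp_norm p g = (\<integral>x. \<bar>g x\<bar> powr q \<partial>leb01) powr (1 / q)" for g
      using False by (simp add: Lp_norm_def q_def)
    have "(\<integral>x. \<bar>v x\<bar> powr q \<partial>leb01) \<le> (\<integral>x. (\<Sum>u\<in>U. c powr q * \<bar>u x\<bar> powr q) \<partial>leb01)"
    proof (rule integral_mono_AE)
      show "integrable leb01 (\<lambda>x. \<Sum>u\<in>U. c powr q * \<bar>u x\<bar> powr q)"
        using int U by (intro Bochner_Integration.integrable_sum integrable_mult_right) auto
      show "AE x in leb01. \<bar>v x\<bar> powr q \<le> (\<Sum>u\<in>U. c powr q * \<bar>u x\<bar> powr q)"
        using ends
      proof eventually_elim
        case (elim x)
        then obtain u where u: "u \<in> U" "\<bar>v x\<bar> \<le> c * \<bar>u x\<bar>" using bound by blast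
        then have "\<bar>v x\<bar> powr q \<le> (c * \<bar>u x\<bar>) powr q" using q by (intro powr_mono2) auto
        also have "\<dots> = c powr q * \<bar>u x\<bar> powr q" using \<open>c \<ge> 0\<close> by (simp add: powr_mult)
        also have "\<dots> \<le> (\<Sum>u\<in>U. c powr q * \<bar>u x\<bar> powr q)"
          using U(1) u(1) by (intro member_le_sum) auto
        finally show ?case .
      qed
    qed (rule int[OF v])
    also have "\<dots> = (\<Sum>u\<in>U. c powr q * (\<integral>x. \<bar>u x\<bar> powr q \<partial>leb01))"
      using int U by (subst Bochner_Integration.integral_sum) auto
    also have "\<dots> \<le> (\<Sum>u\<in>U. c powr q * L powr q)"
    proof (intro sum_mono mult_left_mono)
      fix u assume u: "u \<in> U"
      have "(\<integral>x. \<bar>u x\<bar> powr q \<partial>leb01) = Lp_norm p u powr q"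
        using q by (simp add: norm powr_powr)
      also have "\<dots> \<le> L powr q" using q L[OF u] Lp_norm_nonneg by (intro powr_mono2) auto
      finally show "(\<integral>x. \<bar>u x\<bar> powr q \<partial>leb01) \<le> L powr q" .
    qed simp
    also have "\<dots> = real (card U) * (c powr q * L powr q)" by simp
    \<comment> \<open>Both \<open>card U\<close> and \<open>q\<close> are at least 1, so the
      cardinality may be raised to the power \<open>q\<close>; the right side is then a single
      power.\<close>
    also have "\<dots> \<le> real (card U) powr q * (c powr q * L powr q)"
      using powr_mono[OF q card] card by (intro mult_right_mono) auto
    also have "\<dots> = (real (card U) * c * L) powr q"
      using \<open>c \<ge> 0\<close> \<open>L \<ge> 0\<close> by (simp add: powr_mult)
    finally have "Lp_norm p v \<le> ((real (card U) * c * L) powr q) powr (1 / q)"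
      unfolding norm using q by (intro powr_mono2) auto
    also have "\<dots> = real (card U) * c * L"
      using q \<open>c \<ge> 0\<close> \<open>L \<ge> 0\<close> by (simp add: powr_powr)
    finally show ?thesis .
  qed
qed

theorem theorem2:
  shows "\<exists>C>0. \<forall>(p::ennreal) (T :: (real \<Rightarrow> real) \<Rightarrow> real \<Rightarrow> real) (f :: real \<Rightarrow> real).
    1 \<le> p \<longrightarrow>
    operator_on {0..1} C01 T \<longrightarrow>
    sublinear_on {0..1} C01 T \<longrightarrow>
    monotone_operator_on {0..1} C01 T \<longrightarrow>
    strongly_translatable_on {0..1} C01 T \<longrightarrow>
    f \<in> sobolev 2 \<infinity> \<longrightarrow> f \<in> C01 \<longrightarrow>
    Lp_norm p (\<lambda>x. f x - T f x) \<le> C * sobolev_norm 2 \<infinity> f * test_error p T"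
proof (intro exI[of _ 28] conjI allI impI)
  fix p :: ennreal and T :: "(real \<Rightarrow> real) \<Rightarrow> real \<Rightarrow> real" and f :: "real \<Rightarrow> real"
  assume p: "1 \<le> p" and op: "operator_on {0..1} C01 T"
    and T: "sublinear_on {0..1} C01 T" "monotone_operator_on {0..1} C01 T"
      "strongly_translatable_on {0..1} C01 T"
    and f: "f \<in> sobolev 2 \<infinity>" "f \<in> C01"
  define M where "M = sobolev_norm 2 \<infinity> f"
  \<comment> \<open>The four functions may coincide; the length of the list bounds
    \<open>card U\<close> by 4 in every case.\<close>
  define us where "us = [\<lambda>x. T (e_fun 0) x - e_fun 0 x, \<lambda>x. T (e_fun 1) x - e_fun 1 x,
    \<lambda>x. T (\<lambda>t. - e_fun 1 t) x + e_fun 1 x, \<lambda>x. T (e_fun 2) x - e_fun 2 x]"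
  define U where "U = set us"
  have "M \<ge> 0"
    unfolding M_def sobolev_norm_def
    by (rule order_trans[OF Lp_norm_nonneg Max_ge]) auto
  have TC: "T g \<in> C01" if "g \<in> C01" for g using op that by (simp add: operator_on_def)
  have U: "finite U" "U \<subseteq> C01" by (auto simp: U_def us_def intro!: C01_intros TC)
  have "card U \<le> 4" using card_length[of us] by (simp add: U_def us_def)
  have err: "Lp_norm p u \<le> test_error p T" if "u \<in> U" for u
    unfolding test_error_def using that by (intro Max_ge) (auto simp: U_def us_def)
  have "U \<noteq> {}" by (simp add: U_def us_def)
  then have err_nonneg: "0 \<le> test_error p T"
    using err Lp_norm_nonneg by (meson ex_in_conv order_trans)
  have "Lp_norm p (\<lambda>x. f x - T f x) \<le> real (card U) * (7 * M) * test_error p T"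
  proof (rule Lp_norm_le_finite_family[OF p U _ _ _ err])
    fix x :: real assume x: "0 < x" "x < 1"
    \<comment> \<open>The largest error at \<open>x\<close> is attained by a member of
      \<open>U\<close>, which gives the existential form that the norm estimate asks for.\<close>
    define E where "E = Max ((\<lambda>u. \<bar>u x\<bar>) ` U)"
    have E: "\<bar>u x\<bar> \<le> E" if "u \<in> U" for u
      unfolding E_def using that U(1) by (intro Max_ge) auto
    have "E \<in> (\<lambda>u. \<bar>u x\<bar>) ` U"
      unfolding E_def using U(1) \<open>U \<noteq> {}\<close> by (intro Max_in) auto
    then obtain u where u: "u \<in> U" "E = \<bar>u x\<bar>" by auto
    have "\<bar>f x - T f x\<bar> \<le> 7 * M * E"
      unfolding M_def by (rule operator_pointwise_bound[OF T f x]) (rule E, simp add: U_def us_def)+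
    with u show "\<exists>u\<in>U. \<bar>f x - T f x\<bar> \<le> 7 * M * \<bar>u x\<bar>" by blast
  qed (use \<open>M \<ge> 0\<close> f in \<open>auto intro!: C01_intros TC\<close>)
  also have "\<dots> \<le> 4 * (7 * M) * test_error p T"
    using \<open>card U \<le> 4\<close> \<open>M \<ge> 0\<close> err_nonneg by (intro mult_right_mono) auto
  finally show "Lp_norm p (\<lambda>x. f x - T f x) \<le> 28 * sobolev_norm 2 \<infinity> f * test_error p T"
    by (simp add: M_def)
qed simp

end
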